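(* Let $\mathbf A=(A_n)\in\mathcal S_{\mathcal Y}({\sf BDO}(\Gamma))$ and $A:=\mathrm{s\text{-}lim}\,A_nP_{Y_n}$. Let $h$ tend to infinity such that the limit operator $(\mathrm{Op}(\mathbf A)+P_{\Gamma'})_h$ exists, and assume: for every $n$ there is $k_n$ with $h(n)\in v_{k_n}Y_{k_n}^{-1}$, and $r_n\to\infty$, where $r_n$ is the smallest non-negative integer with $h(n)\in v_{k_n}(\partial_\Omega Y_{k_n})^{-1}\Omega_{r_n}$. Then either $(\mathrm{Op}(\mathbf A)+P_{\Gamma'})_h=R_{v^*}^{-1}AR_{v^*}$ for some $v^*\in\Gamma$, or there is a limit operator $A_g$ of $A$ (with respect to some sequence $g$ tending to infinity) such that $(\mathrm{Op}(\mathbf A)+P_{\Gamma'})_h=A_g$. Conversely, every operator $R_{v^*}^{-1}AR_{v^*}$ with $v^*\in\Gamma$ and every limit operator $A_g$ of $A$ occurs as a limit operator of $\mathrm{Op}(\mathbf A)+P_{\Gamma'}$.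
   Context: $\Gamma$ is a countable discrete group with identity $e$. For $X\subseteq\Gamma$, $P_X$ is the orthogonal projection of $l^2(\Gamma)$ onto $l^2(X)$. For $r\in\Gamma$, $(L_ru)(t)=u(r^{-1}t)$ and $(R_ru)(t)=u(tr)$. ${\sf BDO}(\Gamma)$ is the smallest closed subalgebra of $L(l^2(\Gamma))$ containing all $L_r$ and all multiplication operators $aI$, $a\in l^\infty(\Gamma)$. $\Omega\subseteq\Gamma$ is finite, contains $e$, generates $\Gamma$ as a semigroup; $\Omega_0=\{e\}$, $\Omega_n$ = set of products of at most $n$ elements of $\Omega$. For $A\subseteq\Gamma$: $\mathrm{int}_\Omega A=\{a\in A:\Omega a\subseteq A\}$, $\partial_\Omega A=A\setminus\mathrm{int}_\Omega A$; set products and inverses are elementwise. $\mathcal Y=(Y_n)$ is an increasing sequence of finite subsets of $\Gamma$ with union $\Gamma$. $\mathcal S_{\mathcal Y}({\sf BDO}(\Gamma))$ is the smallest closed $C^*$-subalgebra of the $C^*$-algebra of bounded sequences $(A_n)$ of operators on $\mathrm{im}\,P_{Y_n}$ (componentwise operations, sup norm) containing all $(P_{Y_n}BP_{Y_n})$, $B\in{\sf BDO}(\Gamma)$; for its elements $\mathrm{s\text{-}lim}\,A_nP_{Y_n}$ exists. Fix $(v_n)$ in $\Gamma$ inflating for $Z_n:=(Y_n\cup\Omega_n)(Y_n\cup\Omega_n)^{-1}(Y_n\cup\Omega_n)$, i.e. $Z_mv_m^{-1}\cap Z_nv_n^{-1}=\emptyset$ for $m\ne n$. $\mathrm{Op}(\mathbf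 A):=\sum_nR_{v_n}A_nP_{Y_n}R_{v_n}^{-1}$ (strongly convergent) and $\Gamma':=\Gamma\setminus\bigcup_nY_nv_n^{-1}$. A sequence $h:\mathbb N\to\Gamma$ tends to infinity if for each finite $\Gamma_0$, $h(n)\notin\Gamma_0$ for large $n$. For $B\in L(l^2(\Gamma))$, $B_h$ is the limit operator of $B$ with respect to $h$ if $R_{h(m)}^{-1}BR_{h(m)}\to B_h$ and $R_{h(m)}^{-1}B^*R_{h(m)}\to B_h^*$ strongly. *)

theory Defs
  imports "HOL-Analysis.Analysis" "HOL-Library.Countable" "HOL-Library.Function_Algebras"
begin

text \<open>The group Gamma is a type of class group_add (written additively, possibly
non-commutative): product a b is a + b, inverse is - a, identity e is 0.
Vectors of l2(Gamma) are functions Gamma to complex that are square summable;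
operators are maps on such functions, only their action on l2 matters.\<close>

type_synonym 'g vec = "'g \<Rightarrow> complex"
type_synonym 'g op = "'g vec \<Rightarrow> 'g vec"

definition ell2 :: "'g vec set" where
  "ell2 = {u. (\<lambda>t. (cmod (u t))\<^sup>2) summable_on UNIV}"

definition ell2_norm :: "'g vec \<Rightarrow> real" where
  "ell2_norm u = sqrt (infsum (\<lambda>t. (cmod (u t))\<^sup>2) UNIV)"

definition ell2_inner :: "'g vec \<Rightarrow> 'g vec \<Rightarrow> complex" where
  "ell2_inner u v = infsum (\<lambda>t. cnj (u t) * v t) UNIV"

definition bounded_op :: "'g op \<Rightarrow> bool" where
  "bounded_op B \<longleftrightarrow> (\<forall>u\<in>ell2. B u \<in> ell2)
     \<and> (\<forall>u\<in>ell2. \<forall>w\<in>ell2. B (u + w) = B u + B w)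
     \<and> (\<forall>u\<in>ell2. \<forall>c. B (\<lambda>t. c * u t) = (\<lambda>t. c * B u t))
     \<and> (\<exists>K. \<forall>u\<in>ell2. ell2_norm (B u) \<le> K * ell2_norm u)"

definition op_eq :: "'g op \<Rightarrow> 'g op \<Rightarrow> bool" where
  "op_eq A B \<longleftrightarrow> (\<forall>u\<in>ell2. A u = B u)"

definition adj :: "'g op \<Rightarrow> 'g op" where
  "adj B = (SOME B'. (\<forall>u\<in>ell2. B' u \<in> ell2) \<and>
      (\<forall>u\<in>ell2. \<forall>w\<in>ell2. ell2_inner (B u) w = ell2_inner u (B' w)))"

definition sconv :: "(nat \<Rightarrow> 'g op) \<Rightarrow> 'g op \<Rightarrow> bool" where
  "sconv B C \<longleftrightarrow> (\<forall>u\<in>ell2. C u \<in> ell2 \<and> (\<forall>m. B m u \<in> ell2) \<and>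
      (\<lambda>m. ell2_norm (B m u - C u)) \<longlonglongrightarrow> 0)"

definition proj :: "'g set \<Rightarrow> 'g op" where
  "proj X u = (\<lambda>t. if t \<in> X then u t else 0)"

definition Lsh :: "'g::group_add \<Rightarrow> 'g op" where
  "Lsh r u = (\<lambda>t. u (- r + t))"

definition Rsh :: "'g::group_add \<Rightarrow> 'g op" where
  "Rsh r u = (\<lambda>t. u (t + r))"

definition mult_op :: "'g vec \<Rightarrow> 'g op" where
  "mult_op a u = (\<lambda>t. a t * u t)"

definition bounded_fun :: "'g vec \<Rightarrow> bool" where
  "bounded_fun a \<longleftrightarrow> (\<exists>K. \<forall>t. cmod (a t) \<le> K)"

inductive_set bdo_gen :: "('g::group_add) op set" where
  shift: "Lsh r \<in> bdo_gen"
| mult: "bounded_fun a \<Longrightarrow> mult_op a \<in> bdo_gen"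
| add: "B \<in> bdo_gen \<Longrightarrow> C \<in> bdo_gen \<Longrightarrow> (\<lambda>u. B u + C u) \<in> bdo_gen"
| smult: "B \<in> bdo_gen \<Longrightarrow> (\<lambda>u t. c * B u t) \<in> bdo_gen"
| comp: "B \<in> bdo_gen \<Longrightarrow> C \<in> bdo_gen \<Longrightarrow> B \<circ> C \<in> bdo_gen"

definition BDO :: "('g::group_add) op set" where
  "BDO = {B. bounded_op B \<and> (\<forall>\<epsilon>>0. \<exists>C\<in>bdo_gen.
      \<forall>u\<in>ell2. ell2_norm (B u - C u) \<le> \<epsilon> * ell2_norm u)}"

text \<open>Sequences: the n-th entry A n is an operator on im P_{Y n}, represented by an
operator on l2 of which only the restriction to im P_{Y n} (i.e. A n o P_{Y n}) matters.
Generators of the C*-algebra S_Y(BDO).\<close>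
inductive_set seq_gen :: "(nat \<Rightarrow> ('g::group_add) set) \<Rightarrow> (nat \<Rightarrow> 'g op) set"
  for Y where
  gen: "B \<in> BDO \<Longrightarrow> (\<lambda>n. proj (Y n) \<circ> B \<circ> proj (Y n)) \<in> seq_gen Y"
| add: "A \<in> seq_gen Y \<Longrightarrow> C \<in> seq_gen Y \<Longrightarrow> (\<lambda>n u. A n u + C n u) \<in> seq_gen Y"
| smult: "A \<in> seq_gen Y \<Longrightarrow> (\<lambda>n u t. c * A n u t) \<in> seq_gen Y"
| comp: "A \<in> seq_gen Y \<Longrightarrow> C \<in> seq_gen Y \<Longrightarrow> (\<lambda>n. A n \<circ> C n) \<in> seq_gen Y"
| adjoint: "A \<in> seq_gen Y \<Longrightarrow>
     (\<lambda>n. proj (Y n) \<circ> adj (A n \<circ> proj (Y n)) \<circ> proj (Y n)) \<in> seq_gen Y"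

definition seq_alg :: "(nat \<Rightarrow> ('g::group_add) set) \<Rightarrow> (nat \<Rightarrow> 'g op) \<Rightarrow> bool" where
  "seq_alg Y A \<longleftrightarrow> (\<forall>n. bounded_op (A n \<circ> proj (Y n))) \<and>
     (\<forall>\<epsilon>>0. \<exists>C\<in>seq_gen Y. \<forall>n. \<forall>u\<in>ell2.
        ell2_norm (A n (proj (Y n) u) - C n (proj (Y n) u)) \<le> \<epsilon> * ell2_norm u)"

definition setmul :: "'g::group_add set \<Rightarrow> 'g set \<Rightarrow> 'g set" where
  "setmul A B = {a + b | a b. a \<in> A \<and> b \<in> B}"

definition setinv :: "'g::group_add set \<Rightarrow> 'g set" where
  "setinv A = uminus ` A"

definition Omega_pow :: "'g::group_add set \<Rightarrow> nat \<Rightarrow> 'g set" where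
  "Omega_pow Om n = {sum_list xs | xs. set xs \<subseteq> Om \<and> length xs \<le> n}"

definition int_Om :: "'g::group_add set \<Rightarrow> 'g set \<Rightarrow> 'g set" where
  "int_Om Om A = {a \<in> A. \<forall>w\<in>Om. w + a \<in> A}"

definition bd_Om :: "'g::group_add set \<Rightarrow> 'g set \<Rightarrow> 'g set" where
  "bd_Om Om A = A - int_Om Om A"

definition Zset :: "'g::group_add set \<Rightarrow> (nat \<Rightarrow> 'g set) \<Rightarrow> nat \<Rightarrow> 'g set" where
  "Zset Om Y n = (let W = Y n \<union> Omega_pow Om n in setmul (setmul W (setinv W)) W)"

definition inflating :: "(nat \<Rightarrow> 'g::group_add set) \<Rightarrow> (nat \<Rightarrow> 'g) \<Rightarrow> bool" where
  "inflating Z v \<longleftrightarrow> (\<forall>m n. m \<noteq> n \<longrightarrow>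
      setmul (Z m) {- v m} \<inter> setmul (Z n) {- v n} = {})"

definition Op :: "(nat \<Rightarrow> 'g::group_add set) \<Rightarrow> (nat \<Rightarrow> 'g) \<Rightarrow> (nat \<Rightarrow> 'g op) \<Rightarrow> 'g op" where
  "Op Y v A = (SOME C. sconv (\<lambda>N u. \<Sum>n<N. Rsh (v n) (A n (proj (Y n) (Rsh (- v n) u)))) C)"

definition Gamma' :: "(nat \<Rightarrow> 'g::group_add set) \<Rightarrow> (nat \<Rightarrow> 'g) \<Rightarrow> 'g set" where
  "Gamma' Y v = UNIV - (\<Union>n. setmul (Y n) {- v n})"

definition tends_to_infinity :: "(nat \<Rightarrow> 'g) \<Rightarrow> bool" where
  "tends_to_infinity h \<longleftrightarrow> (\<forall>F. finite F \<longrightarrow> (\<forall>\<^sub>F n in sequentially. h n \<notin> F))"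

definition is_limit_op :: "'g::group_add op \<Rightarrow> (nat \<Rightarrow> 'g) \<Rightarrow> 'g op \<Rightarrow> bool" where
  "is_limit_op B h C \<longleftrightarrow> bounded_op C \<and>
     sconv (\<lambda>m. Rsh (- h m) \<circ> B \<circ> Rsh (h m)) C \<and>
     sconv (\<lambda>m. Rsh (- h m) \<circ> adj B \<circ> Rsh (h m)) (adj C)"

end

theory Submission
  imports Defs
begin

text \<open>
  Every operator \<open>B\<close> in BDO is uniformly local: up to \<open>\<epsilon>\<close>, the column \<open>B \<delta>\<^sub>y\<close> is supported in
  \<open>G y\<close> for a finite set \<open>G\<close> that does not depend on \<open>y\<close>. Hence \<open>P\<^sub>Y B P\<^sub>Y \<delta>\<^sub>y\<close> is close to \<open>B \<delta>\<^sub>y\<close> as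
  soon as \<open>G y \<subseteq> Y\<close>, that is, as soon as \<open>y\<close> lies deep inside \<open>Y\<close>. This property passes
  to sums, products, adjoints and norm limits, so it holds for every sequence \<open>(A\<^sub>n)\<close> of the algebra
  and its strong limit \<open>A\<close>. If \<open>h = v\<^sub>k y\<^sup>-\<^sup>1\<close>, then conjugating the block diagonal operator
  \<open>Op(A) + P\<^sub>\<Gamma>\<^sub>'\<close> by \<open>R\<^sub>h\<close> turns its \<open>k\<close>-th block into \<open>R\<^sub>y A\<^sub>k R\<^sub>y\<^sup>-\<^sup>1\<close>. Consequently, when
  the points \<open>y\<close> move deep into the sets \<open>Y\<^sub>k\<close>, the strong limits of the conjugates of
  \<open>Op(A) + P\<^sub>\<Gamma>\<^sub>'\<close> by \<open>R\<^sub>h\<close> are exactly those of the conjugates of \<open>A\<close> by \<open>R\<^sub>y\<^sup>-\<^sup>1\<close>; the two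
  alternatives correspond to whether or not \<open>y\<close> tends to infinity.
\<close>

subsection \<open>Square-summable functions\<close>

text \<open>Testing on single basis vectors suffices because all families of operators involved are
  uniformly bounded. Two obstacles shape the bookkeeping. Uniform smallness of column tails is in
  general not inherited by adjoints, while a limit operator also demands convergence of the
  adjoints; hence every estimate is carried along in parallel for a sequence and for its adjoints,
  the second half resting on the adjoints of the generators of BDO. Products force the limits
  themselves to be local: an error \<open>a - B\<close> known to be small only on deep columns can
  be applied after \<open>D\<close> only if the columns of \<open>D\<close> essentially live on
  boundedly many points near the diagonal. The growth of the numbers \<open>r\<close> enters through
  a walk: left multiplication by generators cannot lead out of a set without passing through its
  boundary, so a large distance to the boundary leaves room for a large ball. In the converse
  direction the block index is free: it is taken so large that a prescribed finite piece around
  \<open>y\<close> fits into the block and that the resulting \<open>h\<close> avoids a prescribed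
  finite set.\<close>

lemma ell2_bound:
  assumes "0 \<le> K" "\<And>F. finite F \<Longrightarrow> L2_set (\<lambda>t. cmod (u t)) F \<le> K"
  shows "u \<in> ell2" "ell2_norm u \<le> K"
proof -
  have sq: "(\<Sum>t\<in>F. (cmod (u t))\<^sup>2) \<le> K\<^sup>2" if "finite F" for F
    using assms(2)[OF that] unfolding L2_set_def by (rule sqrt_le_D)
  have s: "(\<lambda>t. (cmod (u t))\<^sup>2) summable_on UNIV"
    by (rule nonneg_bdd_above_summable_on) (auto intro!: bdd_aboveI[of _ "K\<^sup>2"] sq)
  then show "u \<in> ell2" by (simp add: ell2_def)
  have "infsum (\<lambda>t. (cmod (u t))\<^sup>2) UNIV \<le> K\<^sup>2"
    by (rule infsum_le_finite_sums[OF s]) (auto intro: sq)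
  then show "ell2_norm u \<le> K" unfolding ell2_norm_def using assms(1)
    by (simp add: real_le_lsqrt)
qed

lemma ell2_norm_nonneg [simp]: "0 \<le> ell2_norm u"
  by (simp add: ell2_norm_def infsum_nonneg)

lemma L2_set_le_ell2_norm:
  assumes "u \<in> ell2"
  shows "L2_set (\<lambda>t. cmod (u t)) F \<le> ell2_norm u"
proof (cases "finite F")
  case True
  then show ?thesis using assms
    by (auto simp: L2_set_def ell2_norm_def ell2_def intro!: finite_sum_le_infsum)
qed simp

lemma cmod_le_ell2_norm: "u \<in> ell2 \<Longrightarrow> cmod (u t) \<le> ell2_norm u"
  using L2_set_le_ell2_norm[of u "{t}"] by (simp add: L2_set_def)

lemma ell2_norm_mono:
  assumes "u \<in> ell2" "\<And>t. cmod (w t) \<le> cmod (u t)"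
  shows "w \<in> ell2" "ell2_norm w \<le> ell2_norm u"
proof -
  have "L2_set (\<lambda>t. cmod (w t)) F \<le> ell2_norm u" for F
    using L2_set_mono[of F "\<lambda>t. cmod (w t)" "\<lambda>t. cmod (u t)"] assms(2)
      L2_set_le_ell2_norm[OF assms(1), of F] by force
  then show "w \<in> ell2" "ell2_norm w \<le> ell2_norm u"
    using ell2_bound[of "ell2_norm u" w] by auto
qed

lemma ell2_add:
  assumes "u \<in> ell2" "w \<in> ell2"
  shows "u + w \<in> ell2" "ell2_norm (u + w) \<le> ell2_norm u + ell2_norm w"
proof -
  have "L2_set (\<lambda>t. cmod ((u + w) t)) F \<le> ell2_norm u + ell2_norm w" for F
  proof -
    have "L2_set (\<lambda>t. cmod ((u + w) t)) F \<le> L2_set (\<lambda>t. cmod (u t) + cmod (w t)) F"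
      by (rule L2_set_mono) (auto simp: norm_triangle_ineq)
    also have "\<dots> \<le> L2_set (\<lambda>t. cmod (u t)) F + L2_set (\<lambda>t. cmod (w t)) F"
      by (rule L2_set_triangle_ineq)
    finally show ?thesis
      using L2_set_le_ell2_norm[OF assms(1), of F] L2_set_le_ell2_norm[OF assms(2), of F] by linarith
  qed
  then show "u + w \<in> ell2" "ell2_norm (u + w) \<le> ell2_norm u + ell2_norm w"
    using ell2_bound[of "ell2_norm u + ell2_norm w" "u + w"] by auto
qed

lemma ell2_norm_cmult: "ell2_norm (\<lambda>t. c * u t) = cmod c * ell2_norm u"
  by (simp add: ell2_norm_def norm_mult power_mult_distrib infsum_cmult_right' real_sqrt_mult)

lemma ell2_cmult: "u \<in> ell2 \<Longrightarrow> (\<lambda>t. c * u t) \<in> ell2"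
  by (auto simp: ell2_def norm_mult power_mult_distrib intro: summable_on_cmult_right)

lemma ell2_zero [simp]: "0 \<in> ell2" "ell2_norm 0 = 0"
  by (simp_all add: ell2_def ell2_norm_def)

lemma ell2_diff:
  assumes "u \<in> ell2" "w \<in> ell2"
  shows "u - w \<in> ell2" "ell2_norm (u - w) \<le> ell2_norm u + ell2_norm w"
proof -
  have e: "u - w = u + (\<lambda>t. (-1) * w t)" by (simp add: fun_eq_iff)
  show "u - w \<in> ell2" unfolding e by (intro ell2_add ell2_cmult assms)
  show "ell2_norm (u - w) \<le> ell2_norm u + ell2_norm w" unfolding e
    using ell2_add(2)[OF assms(1) ell2_cmult[OF assms(2), of "-1"]]
    unfolding ell2_norm_cmult[of "-1" w] by simp
qed

lemma ell2_norm_minus_commute: "ell2_norm (u - w) = ell2_norm (w - u)"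
  by (simp add: ell2_norm_def norm_minus_commute)

lemma ell2_norm_triangle_sub:
  assumes "u \<in> ell2" "w \<in> ell2" "x \<in> ell2"
  shows "ell2_norm (u - x) \<le> ell2_norm (u - w) + ell2_norm (w - x)"
proof -
  have "u - x = (u - w) + (w - x)" by simp
  then show ?thesis using ell2_add(2)[OF ell2_diff(1)[OF assms(1,2)] ell2_diff(1)[OF assms(2,3)]] by simp
qed

lemma ell2_norm_le_add_diff:
  assumes "u \<in> ell2" "w \<in> ell2"
  shows "ell2_norm u \<le> ell2_norm w + ell2_norm (u - w)"
  using ell2_add(2)[OF assms(2) ell2_diff(1)[OF assms]] by simp

lemma proj_ell2:
  assumes "u \<in> ell2"
  shows "proj X u \<in> ell2" "ell2_norm (proj X u) \<le> ell2_norm u"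
  using ell2_norm_mono[OF assms, of "proj X u"] by (auto simp: proj_def)

lemma bij_translations:
  fixes r :: "'g::group_add"
  shows "bij (\<lambda>t. t + r)" "bij (\<lambda>t. - r + t)"
proof -
  show "bij (\<lambda>t. t + r)"
    by (rule bij_betwI[where g = "\<lambda>t. t - r"]) auto
  show "bij (\<lambda>t. - r + t)"
    by (rule bij_betwI[where g = "\<lambda>t. r + t"]) (auto simp: add.assoc[symmetric])
qed

lemma ell2_translate:
  fixes u :: "'g::group_add vec"
  assumes "u \<in> ell2" shows "Rsh r u \<in> ell2" "Lsh r u \<in> ell2"
proof -
  have "bij (\<lambda>t. t + r)" "bij (\<lambda>t. - r + t)"
    by (rule bij_translations)+
  then show "Rsh r u \<in> ell2" "Lsh r u \<in> ell2"
    using assms summable_on_reindex_bij_betw[of "\<lambda>t. t + r" UNIV UNIV "\<lambda>t. (cmod (u t))\<^sup>2"]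
    summable_on_reindex_bij_betw[of "\<lambda>t. - r + t" UNIV UNIV "\<lambda>t. (cmod (u t))\<^sup>2"]
    by (auto simp: ell2_def Rsh_def Lsh_def)
qed

lemma ell2_norm_translate [simp]:
  fixes u :: "'g::group_add vec"
  shows "ell2_norm (Rsh r u) = ell2_norm u" "ell2_norm (Lsh r u) = ell2_norm u"
proof -
  have "bij (\<lambda>t. t + r)" "bij (\<lambda>t. - r + t)"
    by (rule bij_translations)+
  then show "ell2_norm (Rsh r u) = ell2_norm u" "ell2_norm (Lsh r u) = ell2_norm u"
    using infsum_reindex_bij_betw[of "\<lambda>t. t + r" UNIV UNIV "\<lambda>t. (cmod (u t))\<^sup>2"]
    infsum_reindex_bij_betw[of "\<lambda>t. - r + t" UNIV UNIV "\<lambda>t. (cmod (u t))\<^sup>2"]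
    by (auto simp: ell2_norm_def Rsh_def Lsh_def)
qed

text \<open>The standard basis vector at \<open>s\<close>; \<open>B (ket y) s\<close> is the matrix
  entry of \<open>B\<close> in row \<open>s\<close> and column \<open>y\<close>.\<close>

definition ket :: "'g \<Rightarrow> 'g vec" where
  "ket s = (\<lambda>t. if t = s then 1 else 0)"

lemma ket_ell2 [simp]: "ket s \<in> ell2" "ell2_norm (ket s) \<le> 1"
proof -
  have "L2_set (\<lambda>t. cmod (ket s t)) F \<le> 1" if "finite F" for F
  proof -
    have "(\<Sum>t\<in>F. (cmod (ket s t))\<^sup>2) = (\<Sum>t\<in>F. if t = s then 1 else 0)"
      by (rule sum.cong) (auto simp: ket_def)
    then show ?thesis using that by (simp add: L2_set_def)
  qed
  then show "ket s \<in> ell2" "ell2_norm (ket s) \<le> 1"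
    using ell2_bound[of 1 "ket s"] by auto
qed

text \<open>Peels off one coordinate, so that induction over a finite set expands an operator on
  finitely supported vectors into its columns.\<close>

lemma proj_insert: "x \<notin> F \<Longrightarrow> proj (insert x F) u = proj F u + (\<lambda>t. u x * ket x t)"
  by (auto simp: fun_eq_iff proj_def ket_def)

lemma proj_finite_ell2:
  assumes "finite F"
  shows "proj F u \<in> ell2"
  using assms
proof (induction F rule: finite_induct)
  case empty
  have "proj {} u = 0" by (simp add: fun_eq_iff proj_def)
  then show ?case by (metis ell2_zero(1))
next
  case (insert x F)
  then show ?case unfolding proj_insert[OF insert.hyps(2)] by (intro ell2_add ell2_cmult) auto
qed

lemma ell2_norm_proj_finite:
  assumes "finite F"
  shows "ell2_norm (proj F u) = L2_set (\<lambda>t. cmod (u t)) F"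
proof -
  have "infsum (\<lambda>t. (cmod (proj F u t))\<^sup>2) UNIV = infsum (\<lambda>t. (cmod (u t))\<^sup>2) F"
    by (rule infsum_cong_neutral) (auto simp: proj_def)
  then show ?thesis using assms by (simp add: ell2_norm_def L2_set_def)
qed

text \<open>The sum over a suitable finite \<open>F\<close> reaches the total up to the square of
  \<epsilon>, which leaves at most that much for any set disjoint from \<open>F\<close>. One
  \<open>F\<close> serves all \<open>X\<close> at once; this controls the remainders of the block
  series.\<close>

lemma ell2_tail:
  assumes "u \<in> ell2" "0 < \<epsilon>"
  shows "\<exists>F. finite F \<and> (\<forall>X. X \<inter> F = {} \<longrightarrow> ell2_norm (proj X u) \<le> \<epsilon>)"
proof -
  let ?f = "\<lambda>t. (cmod (u t))\<^sup>2"
  have s: "?f summable_on UNIV" using assms(1) by (simp add: ell2_def)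
  obtain F where F: "finite F" "dist (sum ?f F) (infsum ?f UNIV) \<le> \<epsilon>\<^sup>2"
    using infsum_finite_approximation[OF s, of "\<epsilon>\<^sup>2"] assms(2) by auto
  have "ell2_norm (proj X u) \<le> \<epsilon>" if X: "X \<inter> F = {}" for X
  proof (rule ell2_bound(2))
    fix G :: "'a set" assume G: "finite G"
    have "sum ?f (G \<inter> X) + sum ?f F = sum ?f ((G \<inter> X) \<union> F)"
      using G F X by (subst sum.union_disjoint) auto
    also have "\<dots> \<le> infsum ?f UNIV"
      by (rule finite_sum_le_infsum[OF s]) (use G F in auto)
    finally have "sum ?f (G \<inter> X) \<le> \<epsilon>\<^sup>2" using F(2) by (auto simp: dist_real_def)
    moreover have "(\<Sum>t\<in>G. (cmod (proj X u t))\<^sup>2) = sum ?f (G \<inter> X)"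
      using G by (auto simp: sum.inter_restrict proj_def intro!: sum.cong)
    ultimately show "L2_set (\<lambda>t. cmod (proj X u t)) G \<le> \<epsilon>"
      using assms(2) by (simp add: L2_set_def real_le_lsqrt)
  qed (use assms in simp)
  with F show ?thesis by blast
qed

lemma ell2_finite_approx:
  assumes "u \<in> ell2" "0 < \<epsilon>"
  obtains F where "finite F" "ell2_norm (proj (- F) u) \<le> \<epsilon>"
  using ell2_tail[OF assms] by (metis Compl_disjoint2)

section \<open>Inner products\<close>

lemma inner_abs_summable:
  assumes "u \<in> ell2" "w \<in> ell2"
  shows "(\<lambda>t. cmod (cnj (u t) * w t)) summable_on UNIV"
    "infsum (\<lambda>t. cmod (cnj (u t) * w t)) UNIV \<le> ell2_norm u * ell2_norm w"
proof -
  have b: "(\<Sum>t\<in>F. cmod (cnj (u t) * w t)) \<le> ell2_norm u * ell2_norm w" for F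
  proof -
    have "(\<Sum>t\<in>F. cmod (cnj (u t) * w t)) \<le> L2_set (\<lambda>t. cmod (u t)) F * L2_set (\<lambda>t. cmod (w t)) F"
      using L2_set_mult_ineq[of "\<lambda>t. cmod (u t)" "\<lambda>t. cmod (w t)" F] by (simp add: norm_mult)
    also have "\<dots> \<le> ell2_norm u * ell2_norm w"
      by (intro mult_mono L2_set_le_ell2_norm assms) auto
    finally show ?thesis .
  qed
  show s: "(\<lambda>t. cmod (cnj (u t) * w t)) summable_on UNIV"
    by (rule nonneg_bdd_above_summable_on) (auto intro!: bdd_aboveI b)
  show "infsum (\<lambda>t. cmod (cnj (u t) * w t)) UNIV \<le> ell2_norm u * ell2_norm w"
    by (rule infsum_le_finite_sums[OF s]) (rule b)
qed

lemma inner_summable: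
  "u \<in> ell2 \<Longrightarrow> w \<in> ell2 \<Longrightarrow> (\<lambda>t. cnj (u t) * w t) summable_on UNIV"
  by (rule abs_summable_summable[OF inner_abs_summable(1)])

lemma cauchy_schwarz:
  assumes "u \<in> ell2" "w \<in> ell2"
  shows "cmod (ell2_inner u w) \<le> ell2_norm u * ell2_norm w"
  using norm_infsum_bound[OF inner_abs_summable(1)[OF assms]] inner_abs_summable(2)[OF assms]
  by (simp add: ell2_inner_def)

lemma inner_add_left:
  assumes "u \<in> ell2" "x \<in> ell2" "w \<in> ell2"
  shows "ell2_inner (u + x) w = ell2_inner u w + ell2_inner x w"
  using infsum_add[OF inner_summable[OF assms(1,3)] inner_summable[OF assms(2,3)]]
  by (simp add: ell2_inner_def algebra_simps)

lemma inner_commute: "ell2_inner u w = cnj (ell2_inner w u)"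
  by (simp add: ell2_inner_def flip: infsum_cnj) (simp add: mult.commute)

lemma inner_add_right:
  assumes "u \<in> ell2" "x \<in> ell2" "w \<in> ell2"
  shows "ell2_inner w (u + x) = ell2_inner w u + ell2_inner w x"
  by (metis inner_commute inner_add_left[OF assms] complex_cnj_add)

lemma inner_cmult_left: "ell2_inner (\<lambda>t. c * u t) w = cnj c * ell2_inner u w"
  by (simp add: ell2_inner_def mult.assoc infsum_cmult_right')

lemma inner_cmult_right: "ell2_inner w (\<lambda>t. c * u t) = c * ell2_inner w u"
  by (simp add: ell2_inner_def mult.left_commute infsum_cmult_right')

lemma inner_diff_left:
  assumes "u \<in> ell2" "x \<in> ell2" "w \<in> ell2"
  shows "ell2_inner (u - x) w = ell2_inner u w - ell2_inner x w"
  using inner_add_left[OF ell2_diff(1)[OF assms(1,2)] assms(2,3)] by simp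

lemma inner_diff_right:
  assumes "u \<in> ell2" "x \<in> ell2" "w \<in> ell2"
  shows "ell2_inner w (u - x) = ell2_inner w u - ell2_inner w x"
  using inner_add_right[OF ell2_diff(1)[OF assms(1,2)] assms(2,3)] by simp

lemma inner_ket_left: "ell2_inner (ket s) w = w s"
proof -
  have "infsum (\<lambda>t. cnj (ket s t) * w t) UNIV = infsum (\<lambda>t. w t) {s}"
    by (rule infsum_cong_neutral) (auto simp: ket_def)
  then show ?thesis by (simp add: ell2_inner_def)
qed

lemma inner_ket_right: "ell2_inner w (ket s) = cnj (w s)"
  by (subst inner_commute) (simp add: inner_ket_left)

lemma inner_proj: "ell2_inner (proj X u) w = ell2_inner u (proj X w)"
  by (auto simp: ell2_inner_def proj_def intro!: infsum_cong)

lemma inner_Rsh: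
  fixes u w :: "'g::group_add vec"
  shows "ell2_inner (Rsh r u) w = ell2_inner u (Rsh (- r) w)"
proof -
  from infsum_reindex_bij_betw[OF bij_translations(1), of "\<lambda>t. cnj (u t) * w (t - r)" r]
  show ?thesis by (simp add: ell2_inner_def Rsh_def)
qed

lemma inner_Lsh:
  fixes u w :: "'g::group_add vec"
  shows "ell2_inner (Lsh r u) w = ell2_inner u (Lsh (- r) w)"
proof -
  from infsum_reindex_bij_betw[OF bij_translations(2), of "\<lambda>t. cnj (u t) * w (r + t)" r]
  show ?thesis by (simp add: ell2_inner_def Lsh_def add.assoc[symmetric])
qed

subsection \<open>Bounded operators and adjoints\<close>

text \<open>\<open>bounded_op\<close> with an explicit non-negative constant: the arguments on
  strong limits need one constant for a whole sequence.\<close>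

definition op_bound :: "'g op \<Rightarrow> real \<Rightarrow> bool" where
  "op_bound B K \<longleftrightarrow> 0 \<le> K \<and> (\<forall>u\<in>ell2. B u \<in> ell2)
     \<and> (\<forall>u\<in>ell2. \<forall>w\<in>ell2. B (u + w) = B u + B w)
     \<and> (\<forall>u\<in>ell2. \<forall>c. B (\<lambda>t. c * u t) = (\<lambda>t. c * B u t))
     \<and> (\<forall>u\<in>ell2. ell2_norm (B u) \<le> K * ell2_norm u)"

lemma op_boundD:
  assumes "op_bound B K"
  shows "0 \<le> K" "u \<in> ell2 \<Longrightarrow> B u \<in> ell2"
    "u \<in> ell2 \<Longrightarrow> w \<in> ell2 \<Longrightarrow> B (u + w) = B u + B w"
    "u \<in> ell2 \<Longrightarrow> B (\<lambda>t. c * u t) = (\<lambda>t. c * B u t)"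
    "u \<in> ell2 \<Longrightarrow> ell2_norm (B u) \<le> K * ell2_norm u"
  using assms unfolding op_bound_def by blast+

lemma bounded_op_iff: "bounded_op B \<longleftrightarrow> (\<exists>K. op_bound B K)"
proof
  assume b: "bounded_op B"
  then obtain K where K: "\<And>u. u \<in> ell2 \<Longrightarrow> ell2_norm (B u) \<le> K * ell2_norm u"
    unfolding bounded_op_def by blast
  have "ell2_norm (B u) \<le> max K 0 * ell2_norm u" if "u \<in> ell2" for u
    using K[OF that] mult_right_mono[of K "max K 0" "ell2_norm u"] by simp
  then have "op_bound B (max K 0)" using b unfolding bounded_op_def op_bound_def by auto
  then show "\<exists>K. op_bound B K" ..
qed (unfold bounded_op_def op_bound_def, blast)

lemma op_bound_diff:
  assumes "op_bound B K" "u \<in> ell2" "w \<in> ell2"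
  shows "B (u - w) = B u - B w"
  using op_boundD(3)[OF assms(1) ell2_diff(1)[OF assms(2,3)] assms(3)] by simp

lemma op_bound_zero: "op_bound B K \<Longrightarrow> B 0 = 0"
  using op_bound_diff[of B K 0 0] by simp

lemma op_bound_cong:
  assumes "op_bound B K" "\<And>u. u \<in> ell2 \<Longrightarrow> C u = B u"
  shows "op_bound C K"
  using assms(1) assms(2) unfolding op_bound_def
  by (simp add: ell2_add ell2_cmult)

lemma op_bound_plus:
  assumes "op_bound B K" "op_bound C L"
  shows "op_bound (\<lambda>u. B u + C u) (K + L)"
proof -
  have "ell2_norm (B u + C u) \<le> (K + L) * ell2_norm u" if "u \<in> ell2" for u
    using ell2_add(2)[OF op_boundD(2)[OF assms(1) that] op_boundD(2)[OF assms(2) that]]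
      op_boundD(5)[OF assms(1) that] op_boundD(5)[OF assms(2) that]
    by (simp add: distrib_right)
  then show ?thesis
    using op_boundD(1-4)[OF assms(1)] op_boundD(1-4)[OF assms(2)] unfolding op_bound_def
    by (auto intro: ell2_add(1) simp: fun_eq_iff algebra_simps)
qed

lemma op_bound_minus:
  assumes "op_bound B K" "op_bound C L"
  shows "op_bound (\<lambda>u. B u - C u) (K + L)"
proof -
  have "ell2_norm (B u - C u) \<le> (K + L) * ell2_norm u" if "u \<in> ell2" for u
    using ell2_diff(2)[OF op_boundD(2)[OF assms(1) that] op_boundD(2)[OF assms(2) that]]
      op_boundD(5)[OF assms(1) that] op_boundD(5)[OF assms(2) that]
    by (simp add: distrib_right)
  then show ?thesis
    using op_boundD(1-4)[OF assms(1)] op_boundD(1-4)[OF assms(2)] unfolding op_bound_def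
    by (auto intro: ell2_diff(1) simp: fun_eq_iff algebra_simps)
qed

lemma op_bound_improve:
  assumes "op_bound B K" "0 \<le> L" "\<And>u. u \<in> ell2 \<Longrightarrow> ell2_norm (B u) \<le> L * ell2_norm u"
  shows "op_bound B L"
  using assms unfolding op_bound_def by auto

lemma op_bound_cmult:
  assumes "op_bound B K"
  shows "op_bound (\<lambda>u t. c * B u t) (cmod c * K)"
proof -
  have "ell2_norm (\<lambda>t. c * B u t) \<le> cmod c * K * ell2_norm u" if "u \<in> ell2" for u
    using mult_left_mono[OF op_boundD(5)[OF assms that], of "cmod c"]
    by (simp add: ell2_norm_cmult mult.assoc)
  then show ?thesis
    using op_boundD(1-4)[OF assms] unfolding op_bound_def
    by (auto intro: ell2_cmult simp: fun_eq_iff algebra_simps)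
qed

lemma op_bound_comp:
  assumes "op_bound B K" "op_bound C L"
  shows "op_bound (B \<circ> C) (K * L)"
proof -
  have "ell2_norm (B (C u)) \<le> K * L * ell2_norm u" if "u \<in> ell2" for u
    using op_boundD(5)[OF assms(1) op_boundD(2)[OF assms(2) that]]
      mult_left_mono[OF op_boundD(5)[OF assms(2) that] op_boundD(1)[OF assms(1)]]
    by (simp add: mult.assoc)
  then show ?thesis
    using op_boundD(1-4)[OF assms(1)] op_boundD(1-4)[OF assms(2)] unfolding op_bound_def
    by auto
qed

lemma op_bound_proj: "op_bound (proj X) 1"
proof -
  have "proj X (u + w) = proj X u + proj X w" "proj X (\<lambda>t. c * u t) = (\<lambda>t. c * proj X u t)" for u w c
    by (auto simp: proj_def fun_eq_iff)
  then show ?thesis by (auto simp: op_bound_def proj_ell2)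
qed

lemma op_bound_translate:
  fixes r :: "'g::group_add"
  shows "op_bound (Rsh r) 1" "op_bound (Lsh r) 1"
  by (auto simp: op_bound_def ell2_translate) (auto simp: Rsh_def Lsh_def fun_eq_iff)

lemma op_bound_mult:
  assumes "\<And>t. cmod (a t) \<le> K"
  shows "op_bound (mult_op a) K"
proof -
  have K: "0 \<le> K" using assms norm_ge_zero order_trans by blast
  have "mult_op a u \<in> ell2 \<and> ell2_norm (mult_op a u) \<le> K * ell2_norm u" if "u \<in> ell2" for u
  proof -
    have *: "cmod (mult_op a u t) \<le> cmod (complex_of_real K * u t)" for t
      using K mult_right_mono[OF assms[of t] norm_ge_zero[of "u t"]] by (simp add: mult_op_def norm_mult)
    from ell2_norm_mono[OF ell2_cmult[OF that, of "complex_of_real K"] *]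
    show ?thesis using K by (simp add: ell2_norm_cmult)
  qed
  then show ?thesis using K unfolding op_bound_def
    by (auto simp: mult_op_def fun_eq_iff algebra_simps)
qed

text \<open>Splits \<open>u\<close> at \<open>S\<close> and expands the part on \<open>S\<close> in
  basis vectors. The sum is a crude bound, but \<open>S\<close> will be of bounded size, so
  smallness of the columns \<open>E (ket s)\<close> survives it.\<close>

lemma op_bound_apply_proj:
  assumes E: "op_bound E M" and u: "u \<in> ell2" and S: "finite S"
  shows "ell2_norm (E u) \<le> M * ell2_norm (proj (- S) u) + (\<Sum>s\<in>S. cmod (u s) * ell2_norm (E (ket s)))"
proof -
  have fin: "ell2_norm (E (proj S u)) \<le> (\<Sum>s\<in>S. cmod (u s) * ell2_norm (E (ket s)))"
    using S
  proof (induction S rule: finite_induct)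
    case empty
    have "proj {} u = 0" by (simp add: fun_eq_iff proj_def)
    then show ?case using op_bound_zero[OF E] by (metis ell2_zero(2) order_refl sum.empty)
  next
    case (insert x F)
    have m: "proj F u \<in> ell2" "(\<lambda>t. u x * ket x t) \<in> ell2" by (auto intro: proj_finite_ell2 insert ell2_cmult)
    have "E (proj (insert x F) u) = E (proj F u) + E (\<lambda>t. u x * ket x t)"
      unfolding proj_insert[OF insert.hyps(2)] by (rule op_boundD(3)[OF E m])
    also have "E (\<lambda>t. u x * ket x t) = (\<lambda>t. u x * E (ket x) t)"
      by (rule op_boundD(4)[OF E]) simp
    finally have "ell2_norm (E (proj (insert x F) u)) \<le> ell2_norm (E (proj F u)) + cmod (u x) * ell2_norm (E (ket x))"
      using ell2_add(2)[OF op_boundD(2)[OF E m(1)] ell2_cmult[OF op_boundD(2)[OF E ket_ell2(1)]], of "u x" x]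
      by (simp only: ell2_norm_cmult)
    then show ?case using insert by simp
  qed
  have "u = proj (- S) u + proj S u" by (auto simp: fun_eq_iff proj_def)
  then have "E u = E (proj (- S) u) + E (proj S u)"
    using op_boundD(3)[OF E proj_ell2(1)[OF u, of "- S"] proj_ell2(1)[OF u, of S]] by metis
  then have "ell2_norm (E u) \<le> ell2_norm (E (proj (- S) u)) + ell2_norm (E (proj S u))"
    using ell2_add(2)[OF op_boundD(2)[OF E proj_ell2(1)[OF u, of "- S"]] op_boundD(2)[OF E proj_ell2(1)[OF u, of S]]]
    by simp
  then show ?thesis using fin op_boundD(5)[OF E proj_ell2(1)[OF u, of "- S"]] by linarith
qed

text \<open>The property that \<open>adj\<close> selects by \<open>SOME\<close>, as a relation:
  concrete adjoints can be computed and then identified with \<open>adj\<close>, because they are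
  unique on \<open>ell2\<close>.\<close>

definition is_adj :: "'g op \<Rightarrow> 'g op \<Rightarrow> bool" where
  "is_adj B B' \<longleftrightarrow> (\<forall>u\<in>ell2. B' u \<in> ell2) \<and>
      (\<forall>u\<in>ell2. \<forall>w\<in>ell2. ell2_inner (B u) w = ell2_inner u (B' w))"

text \<open>The adjoint is written down by coordinates. For finitely supported \<open>u\<close> the
  adjoint relation is linearity; the bound comes from testing with truncations of
  \<open>B' w\<close>; density of finitely supported vectors does the rest.\<close>

lemma is_adj_exists:
  assumes B: "op_bound B K"
  shows "\<exists>B'. is_adj B B'"
proof -
  define B' where "B' = (\<lambda>w t. ell2_inner (B (ket t)) w)"
  have fin: "ell2_inner (B (proj F u)) w = (\<Sum>t\<in>F. cnj (u t) * B' w t)"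
    if "finite F" "w \<in> ell2" for F u w
    using that(1)
  proof (induction F rule: finite_induct)
    case empty
    have "proj {} u = 0" by (simp add: fun_eq_iff proj_def)
    then have "B (proj {} u) = 0" using op_bound_zero[OF B] by metis
    then show ?case by (simp add: ell2_inner_def)
  next
    case (insert x F)
    have m: "proj F u \<in> ell2" "(\<lambda>t. u x * ket x t) \<in> ell2" by (auto intro: proj_finite_ell2 insert ell2_cmult)
    have "B (proj (insert x F) u) = B (proj F u) + B (\<lambda>t. u x * ket x t)"
      unfolding proj_insert[OF insert.hyps(2)] by (rule op_boundD(3)[OF B m])
    moreover have "B (\<lambda>t. u x * ket x t) = (\<lambda>t. u x * B (ket x) t)"
      by (rule op_boundD(4)[OF B]) simp
    ultimately have "ell2_inner (B (proj (insert x F) u)) w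
      = ell2_inner (B (proj F u)) w + cnj (u x) * B' w x"
      using inner_add_left[OF op_boundD(2)[OF B m(1)] ell2_cmult[OF op_boundD(2)[OF B ket_ell2(1)]] that(2), of "u x" x]
      by (simp add: inner_cmult_left B'_def)
    then show ?case using insert by simp
  qed
  have K: "0 \<le> K" by (rule op_boundD(1)[OF B])
  have B': "B' w \<in> ell2" "ell2_norm (B' w) \<le> K * ell2_norm w" if w: "w \<in> ell2" for w
  proof -
    have "L2_set (\<lambda>t. cmod (B' w t)) F \<le> K * ell2_norm w" if F: "finite F" for F
    proof -
      let ?L = "L2_set (\<lambda>t. cmod (B' w t)) F"
      \<comment> \<open>Testing with this truncation produces the square of \<open>?L\<close>, while
        the bound for \<open>B\<close> contains \<open>?L\<close> only once; cancelling one factor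
        leaves the claim.\<close>
      let ?x = "proj F (B' w)"
      have "ell2_inner (B ?x) w = (\<Sum>t\<in>F. complex_of_real ((cmod (B' w t))\<^sup>2))"
        unfolding fin[OF F w] complex_norm_square by (simp add: mult.commute)
      also have "\<dots> = complex_of_real (?L\<^sup>2)"
        by (simp add: L2_set_def sum_nonneg)
      finally have "?L\<^sup>2 = cmod (ell2_inner (B ?x) w)" by (simp add: norm_power)
      also have "\<dots> \<le> ell2_norm (B ?x) * ell2_norm w"
        by (rule cauchy_schwarz[OF op_boundD(2)[OF B proj_finite_ell2[OF F]] w])
      also have "\<dots> \<le> (K * ?L) * ell2_norm w"
        using op_boundD(5)[OF B proj_finite_ell2[OF F], of "B' w"]
        by (intro mult_right_mono) (simp_all add: ell2_norm_proj_finite[OF F])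
      finally have "?L * ?L \<le> ?L * (K * ell2_norm w)" by (simp add: power2_eq_square algebra_simps)
      then show ?thesis
        using K mult_nonneg_nonneg[OF K ell2_norm_nonneg[of w]]
        by (cases "?L = 0") (auto simp: mult_le_cancel_left less_le)
    qed
    then show "B' w \<in> ell2" "ell2_norm (B' w) \<le> K * ell2_norm w"
      using ell2_bound[of "K * ell2_norm w" "B' w"] K by auto
  qed
  have "ell2_inner (B u) w = ell2_inner u (B' w)" if u: "u \<in> ell2" and w: "w \<in> ell2" for u w
  proof -
    let ?d = "\<lambda>x. ell2_inner (B x) w - ell2_inner x (B' w)"
    have "cmod (?d u) \<le> \<epsilon>" if eps: "0 < \<epsilon>" for \<epsilon>
    proof -
      \<comment> \<open>The tail of \<open>u\<close> contributes one error on each side of the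
        relation, each at most \<open>K * ell2_norm w\<close> times its norm. The summand 1 keeps
        the divisor positive.\<close>
      define M where "M = 2 * K * ell2_norm w + 1"
      have M: "0 < M" using K by (simp add: M_def add_nonneg_pos)
      obtain F where F: "finite F" "ell2_norm (proj (- F) u) \<le> \<epsilon> / M"
        by (rule ell2_finite_approx[OF u, of "\<epsilon> / M"]) (use eps M in auto)
      let ?p = "proj F u" and ?q = "proj (- F) u"
      have pq: "?p \<in> ell2" "?q \<in> ell2" by (auto intro: proj_ell2 u)
      have e: "u = ?p + ?q" by (auto simp: fun_eq_iff proj_def)
      have "ell2_inner ?p (B' w) = (\<Sum>t\<in>F. cnj (u t) * B' w t)"
      proof -
        have "infsum (\<lambda>t. cnj (?p t) * B' w t) UNIV = infsum (\<lambda>t. cnj (u t) * B' w t) F"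
          by (rule infsum_cong_neutral) (auto simp: proj_def)
        then show ?thesis using F(1) by (simp add: ell2_inner_def)
      qed
      then have "?d ?p = 0" using fin[OF F(1) w, of u] by simp
      moreover have "?d u = ?d ?p + ?d ?q"
        using op_boundD(3)[OF B pq] inner_add_left[OF op_boundD(2)[OF B pq(1)] op_boundD(2)[OF B pq(2)] w]
          inner_add_left[OF pq B'(1)[OF w]] e by (metis add_diff_add)
      ultimately have "cmod (?d u) \<le> cmod (ell2_inner (B ?q) w) + cmod (ell2_inner ?q (B' w))"
        using norm_triangle_ineq4 by simp
      also have "\<dots> \<le> (K * ell2_norm ?q) * ell2_norm w + ell2_norm ?q * (K * ell2_norm w)"
        using cauchy_schwarz[OF op_boundD(2)[OF B pq(2)] w] cauchy_schwarz[OF pq(2) B'(1)[OF w]]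
          mult_right_mono[OF op_boundD(5)[OF B pq(2)] ell2_norm_nonneg[of w]]
          mult_left_mono[OF B'(2)[OF w] ell2_norm_nonneg[of ?q]] by linarith
      also have "\<dots> \<le> M * ell2_norm ?q" by (simp add: M_def algebra_simps)
      also have "\<dots> \<le> M * (\<epsilon> / M)" using F(2) M by (intro mult_left_mono) auto
      finally show ?thesis using M by simp
    qed
    then have "cmod (?d u) \<le> 0" by (meson dense_ge)
    then show ?thesis by simp
  qed
  then have "is_adj B B'" using B' by (auto simp: is_adj_def)
  then show ?thesis by (rule exI[of _ B'])
qed

lemma is_adj_adj:
  assumes "bounded_op B" shows "is_adj B (adj B)"
proof -
  obtain K where "op_bound B K" using assms bounded_op_iff by blast
  then have "\<exists>B'. is_adj B B'" by (rule is_adj_exists)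
  then show ?thesis unfolding is_adj_def adj_def by (rule someI_ex)
qed

lemma is_adj_unique:
  assumes "is_adj B C" "is_adj B D" "u \<in> ell2" shows "C u = D u"
proof
  fix t
  have "ell2_inner (ket t) (C u) = ell2_inner (ket t) (D u)"
    using assms unfolding is_adj_def by (metis ket_ell2(1))
  then show "C u t = D u t" by (simp add: inner_ket_left)
qed

text \<open>An adjoint is only asked to preserve \<open>ell2\<close> and to satisfy the pairing
  identity. Linearity follows from the formula \<open>C u t = ell2_inner (B (ket t)) u\<close>, the
  bound again from testing with truncations.\<close>

lemma is_adj_op_bound:
  assumes B: "op_bound B K" and C: "is_adj B C" shows "op_bound C K"
proof -
  have K: "0 \<le> K" by (rule op_boundD(1)[OF B])
  have Cm: "C u \<in> ell2" if "u \<in> ell2" for u using C that by (auto simp: is_adj_def)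
  have Ct: "C u t = ell2_inner (B (ket t)) u" if "u \<in> ell2" for u t
    using C that unfolding is_adj_def by (metis ket_ell2(1) inner_ket_left)
  have "ell2_norm (C u) \<le> K * ell2_norm u" if u: "u \<in> ell2" for u
  proof (rule ell2_bound(2))
    fix F :: "'a set" assume F: "finite F"
    let ?L = "L2_set (\<lambda>t. cmod (C u t)) F"
    let ?x = "proj F (C u)"
    have x: "?x \<in> ell2" "ell2_norm ?x = ?L" by (auto intro: proj_finite_ell2 ell2_norm_proj_finite F)
    have "ell2_inner ?x (C u) = (\<Sum>t\<in>F. complex_of_real ((cmod (C u t))\<^sup>2))"
    proof -
      have "infsum (\<lambda>t. cnj (?x t) * C u t) UNIV = infsum (\<lambda>t. complex_of_real ((cmod (C u t))\<^sup>2)) F"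
        unfolding complex_norm_square by (rule infsum_cong_neutral) (auto simp: proj_def)
      then show ?thesis using F by (simp add: ell2_inner_def)
    qed
    also have "\<dots> = complex_of_real (?L\<^sup>2)" by (simp add: L2_set_def sum_nonneg)
    finally have "complex_of_real (?L\<^sup>2) = ell2_inner (B ?x) u"
      using C x(1) u by (simp add: is_adj_def)
    then have "?L\<^sup>2 = cmod (ell2_inner (B ?x) u)" by (metis abs_power2 norm_of_real)
    also have "\<dots> \<le> ell2_norm (B ?x) * ell2_norm u"
      by (rule cauchy_schwarz[OF op_boundD(2)[OF B x(1)] u])
    also have "\<dots> \<le> (K * ?L) * ell2_norm u"
      using op_boundD(5)[OF B x(1)] x(2) by (intro mult_right_mono) simp_all
    finally have "?L * ?L \<le> ?L * (K * ell2_norm u)" by (simp add: power2_eq_square algebra_simps)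
    then show "?L \<le> K * ell2_norm u"
      using K mult_nonneg_nonneg[OF K ell2_norm_nonneg[of u]]
      by (cases "?L = 0") (auto simp: mult_le_cancel_left less_le)
  qed (use K in simp)
  moreover have "C (u + w) = C u + C w" if "u \<in> ell2" "w \<in> ell2" for u w
    using inner_add_right[OF that op_boundD(2)[OF B ket_ell2(1)]] that
    by (simp add: fun_eq_iff Ct ell2_add)
  moreover have "C (\<lambda>t. c * u t) = (\<lambda>t. c * C u t)" if "u \<in> ell2" for u c
    using that by (simp add: fun_eq_iff Ct ell2_cmult inner_cmult_right)
  ultimately show ?thesis using K Cm by (auto simp: op_bound_def)
qed

lemma is_adj_sym:
  assumes "op_bound B K" "is_adj B C" shows "is_adj C B"
  using op_boundD(2)[OF assms(1)] assms(2) unfolding is_adj_def by (metis inner_commute)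

lemma is_adj_plus:
  assumes "is_adj B B'" "is_adj C C'" "op_bound B K" "op_bound C L"
  shows "is_adj (\<lambda>u. B u + C u) (\<lambda>u. B' u + C' u)"
  using assms(1,2) op_boundD(2)[OF assms(3)] op_boundD(2)[OF assms(4)]
  by (auto simp: is_adj_def inner_add_left inner_add_right intro: ell2_add(1))

lemma is_adj_minus:
  assumes "is_adj B B'" "is_adj C C'" "op_bound B K" "op_bound C L"
  shows "is_adj (\<lambda>u. B u - C u) (\<lambda>u. B' u - C' u)"
  using assms(1,2) op_boundD(2)[OF assms(3)] op_boundD(2)[OF assms(4)]
  by (auto simp: is_adj_def inner_diff_left inner_diff_right intro: ell2_diff(1))

lemma is_adj_cmult:
  assumes "is_adj B B'"
  shows "is_adj (\<lambda>u t. c * B u t) (\<lambda>u t. cnj c * B' u t)"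
  using assms by (auto simp: is_adj_def inner_cmult_left inner_cmult_right intro: ell2_cmult)

lemma is_adj_comp:
  assumes "is_adj B B'" "is_adj C C'" "op_bound C L"
  shows "is_adj (B \<circ> C) (C' \<circ> B')"
  using assms(1,2) op_boundD(2)[OF assms(3)] by (auto simp: is_adj_def)

lemma is_adj_proj: "is_adj (proj X) (proj X)"
  by (auto simp: is_adj_def inner_proj proj_ell2)

lemma is_adj_Rsh: "is_adj (Rsh r) (Rsh (- r))"
  by (auto simp: is_adj_def inner_Rsh ell2_translate)

lemma is_adj_Lsh: "is_adj (Lsh r) (Lsh (- r))"
  by (auto simp: is_adj_def inner_Lsh ell2_translate)

lemma is_adj_mult:
  assumes "bounded_fun a" shows "is_adj (mult_op a) (mult_op (\<lambda>t. cnj (a t)))"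
proof -
  obtain K where "\<And>t. cmod (a t) \<le> K" using assms by (auto simp: bounded_fun_def)
  then have "op_bound (mult_op (\<lambda>t. cnj (a t))) K" by (intro op_bound_mult) auto
  then show ?thesis
    using op_boundD(2) unfolding is_adj_def
    by (auto simp: ell2_inner_def mult_op_def[abs_def] mult_ac intro!: infsum_cong)
qed

lemma is_adj_cong:
  assumes "is_adj B B'" "\<And>u. u \<in> ell2 \<Longrightarrow> C u = B u" "\<And>u. u \<in> ell2 \<Longrightarrow> C' u = B' u"
  shows "is_adj C C'"
  using assms by (auto simp: is_adj_def)

text \<open>\<open>B' - C'\<close> is the adjoint of \<open>B - C\<close> and inherits its bound.
  This carries norm approximations over to adjoints.\<close>

lemma is_adj_diff_norm:
  assumes "is_adj B B'" "is_adj C C'" "op_bound B K" "op_bound C L" "0 \<le> \<epsilon>"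
    and "\<And>u. u \<in> ell2 \<Longrightarrow> ell2_norm (B u - C u) \<le> \<epsilon> * ell2_norm u" "u \<in> ell2"
  shows "ell2_norm (B' u - C' u) \<le> \<epsilon> * ell2_norm u"
proof -
  have "op_bound (\<lambda>u. B u - C u) \<epsilon>"
    by (rule op_bound_improve[OF op_bound_minus[OF assms(3,4)]]) (use assms in auto)
  from op_boundD(5)[OF is_adj_op_bound[OF this is_adj_minus[OF assms(1-4)]] assms(7)]
  show ?thesis .
qed

subsection \<open>Strong convergence\<close>

text \<open>The uniform bound makes the contribution of the tail of \<open>u\<close> small for all
  \<open>m\<close> at once; what remains involves finitely many columns.\<close>

lemma strong_limit_from_ket:
  assumes D: "\<And>m. op_bound (D m) K" and lim: "\<And>s. (\<lambda>m. ell2_norm (D m (ket s))) \<longlonglongrightarrow> 0"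
    and u: "u \<in> ell2"
  shows "(\<lambda>m. ell2_norm (D m u)) \<longlonglongrightarrow> 0"
proof (rule LIMSEQ_I)
  fix \<epsilon> :: real assume e: "0 < \<epsilon>"
  \<comment> \<open>\<open>K\<close> may be 0, so \<open>K + 1\<close> is used as the divisor; one
    half of \<epsilon> goes to the tail and one half to the columns.\<close>
  have K: "0 < 2 * (K + 1)" using op_boundD(1)[OF D[of 0]] by simp
  obtain F where F: "finite F" "ell2_norm (proj (- F) u) \<le> \<epsilon> / (2 * (K + 1))"
    by (rule ell2_finite_approx[OF u, of "\<epsilon> / (2 * (K + 1))"]) (use e K in auto)
  have "(\<lambda>m. \<Sum>s\<in>F. cmod (u s) * ell2_norm (D m (ket s))) \<longlonglongrightarrow> (\<Sum>s\<in>F. cmod (u s) * 0)"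
    by (intro tendsto_sum tendsto_mult lim tendsto_const)
  then have "(\<lambda>m. \<Sum>s\<in>F. cmod (u s) * ell2_norm (D m (ket s))) \<longlonglongrightarrow> 0" by simp
  from LIMSEQ_D[OF this, of "\<epsilon>/2"] e obtain N where
    N: "\<And>m. m \<ge> N \<Longrightarrow> \<bar>\<Sum>s\<in>F. cmod (u s) * ell2_norm (D m (ket s))\<bar> < \<epsilon>/2" by auto
  have "ell2_norm (D m u) < \<epsilon>" if "m \<ge> N" for m
  proof -
    have "K * ell2_norm (proj (- F) u) \<le> (K + 1) * (\<epsilon> / (2 * (K + 1)))"
      using F(2) op_boundD(1)[OF D[of 0]] by (intro mult_mono) auto
    also have "\<dots> = \<epsilon>/2" using K by (simp add: field_simps)
    finally show ?thesis using op_bound_apply_proj[OF D u F(1), of m] N[OF that] by linarith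
  qed
  then show "\<exists>N. \<forall>m\<ge>N. norm (ell2_norm (D m u) - 0) < \<epsilon>" by auto
qed

text \<open>Coordinates are dominated by the norm. Pointwise limits are enough to identify strong
  limits and to hand linearity on to them.\<close>

lemma sconv_pointwise:
  assumes "sconv B C" "u \<in> ell2"
  shows "(\<lambda>m. B m u t) \<longlonglongrightarrow> C u t"
proof (rule LIM_zero_cancel, rule Lim_null_comparison)
  show "(\<lambda>m. ell2_norm (B m u - C u)) \<longlonglongrightarrow> 0" using assms by (auto simp: sconv_def)
  have "cmod (B m u t - C u t) \<le> ell2_norm (B m u - C u)" for m
    using cmod_le_ell2_norm[OF ell2_diff(1), of "B m u" "C u" t] assms by (simp add: sconv_def)
  then show "\<forall>\<^sub>F m in sequentially. cmod (B m u t - C u t) \<le> ell2_norm (B m u - C u)" by simp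
qed

lemma sconv_unique: "sconv B C \<Longrightarrow> sconv B D \<Longrightarrow> u \<in> ell2 \<Longrightarrow> C u = D u"
  by (rule ext) (metis LIMSEQ_unique sconv_pointwise)

lemma sconv_op_bound:
  assumes B: "\<And>m. op_bound (B m) K" and s: "sconv B C"
  shows "op_bound C K"
proof -
  have Cm: "C u \<in> ell2" if "u \<in> ell2" for u using s that by (auto simp: sconv_def)
  have "C (u + w) = C u + C w" if "u \<in> ell2" "w \<in> ell2" for u w
  proof
    fix t
    have "(\<lambda>m. B m (u + w) t) \<longlonglongrightarrow> C u t + C w t"
      unfolding op_boundD(3)[OF B that] using sconv_pointwise[OF s that(1), of t] sconv_pointwise[OF s that(2), of t]
      by (auto intro: tendsto_add)
    then show "C (u + w) t = (C u + C w) t"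
      using sconv_pointwise[OF s ell2_add(1)[OF that], of t] LIMSEQ_unique by auto
  qed
  moreover have "C (\<lambda>t. c * u t) = (\<lambda>t. c * C u t)" if "u \<in> ell2" for u c
  proof
    fix t
    have "(\<lambda>m. B m (\<lambda>t. c * u t) t) \<longlonglongrightarrow> c * C u t"
      unfolding op_boundD(4)[OF B that] using sconv_pointwise[OF s that, of t]
      by (intro tendsto_mult_left)
    then show "C (\<lambda>t. c * u t) t = c * C u t"
      using sconv_pointwise[OF s ell2_cmult[OF that], of c t] LIMSEQ_unique by blast
  qed
  moreover have "ell2_norm (C u) \<le> K * ell2_norm u" if u: "u \<in> ell2" for u
  proof (rule LIMSEQ_le_const)
    have "(\<lambda>m. K * ell2_norm u + ell2_norm (B m u - C u)) \<longlonglongrightarrow> K * ell2_norm u + 0"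
      using s u by (intro tendsto_add tendsto_const) (auto simp: sconv_def)
    then show "(\<lambda>m. K * ell2_norm u + ell2_norm (B m u - C u)) \<longlonglongrightarrow> K * ell2_norm u" by simp
    have "ell2_norm (C u) \<le> K * ell2_norm u + ell2_norm (B m u - C u)" for m
      using ell2_norm_le_add_diff[OF Cm[OF u] op_boundD(2)[OF B u, of m]] op_boundD(5)[OF B u, of m]
        ell2_norm_minus_commute[of "C u" "B m u"] by linarith
    then show "\<exists>N. \<forall>n\<ge>N. ell2_norm (C u) \<le> K * ell2_norm u + ell2_norm (B n u - C u)" by auto
  qed
  ultimately show ?thesis using Cm op_boundD(1)[OF B[of 0]] by (auto simp: op_bound_def)
qed

subsection \<open>Uniform locality and convergence deep inside the sets\<close>

definition local_op :: "'g::group_add op \<Rightarrow> bool" where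
  "local_op B \<longleftrightarrow> (\<forall>\<epsilon>>0. \<exists>G. finite G \<and>
     (\<forall>y. ell2_norm (proj (- ((\<lambda>g. g + y) ` G)) (B (ket y))) \<le> \<epsilon>))"

text \<open>The estimate is uniform in \<open>k\<close> and \<open>y\<close>. For uniformly bounded
  families, a fixed \<open>y\<close> gives strong convergence along an exhaustion; a moving
  \<open>y\<close> lets the blocks be compared with the limit far out in the group.\<close>

definition deep_conv :: "(nat \<Rightarrow> 'g::group_add set) \<Rightarrow> (nat \<Rightarrow> 'g op) \<Rightarrow> 'g op \<Rightarrow> bool" where
  "deep_conv Y a B \<longleftrightarrow> (\<forall>\<epsilon>>0. \<exists>G. finite G \<and>
     (\<forall>k y. (\<lambda>g. g + y) ` G \<subseteq> Y k \<longrightarrow> ell2_norm (a k (ket y) - B (ket y)) \<le> \<epsilon>))"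

lemma local_opD:
  assumes "local_op B" "0 < \<epsilon>"
  obtains G where "finite G" "\<And>y. ell2_norm (proj (- ((\<lambda>g. g + y) ` G)) (B (ket y))) \<le> \<epsilon>"
  using assms unfolding local_op_def by blast

lemma deep_convD:
  assumes "deep_conv Y a B" "0 < \<epsilon>"
  obtains G where "finite G"
    "\<And>k y. (\<lambda>g. g + y) ` G \<subseteq> Y k \<Longrightarrow> ell2_norm (a k (ket y) - B (ket y)) \<le> \<epsilon>"
  using assms unfolding deep_conv_def by blast

lemma op_bound_ket:
  assumes "op_bound B K"
  shows "ell2_norm (B (ket y)) \<le> K" "cmod (B (ket y) s) \<le> K"
proof -
  show *: "ell2_norm (B (ket y)) \<le> K"
    using op_boundD(5)[OF assms ket_ell2(1), of y]
      mult_left_mono[OF ket_ell2(2)[of y] op_boundD(1)[OF assms]] by linarith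
  show "cmod (B (ket y) s) \<le> K"
    using cmod_le_ell2_norm[OF op_boundD(2)[OF assms ket_ell2(1)], of y s] * by linarith
qed

lemma ell2_norm_proj_mono:
  assumes "u \<in> ell2" "X \<subseteq> X'"
  shows "ell2_norm (proj X u) \<le> ell2_norm (proj X' u)"
  by (rule ell2_norm_mono(2)[OF proj_ell2(1)[OF assms(1)]]) (use assms(2) in \<open>auto simp: proj_def\<close>)

text \<open>Up to a tail of norm \<open>e1\<close>, \<open>D (ket y)\<close> lives on at most
  \<open>card G\<close> points, has entries bounded by \<open>L\<close> there, and \<open>E\<close>
  is small on each of these points. With \<open>E\<close> a cut-off of an operator this yields
  locality of products, with \<open>E\<close> the difference \<open>a k - B\<close> their deep
  convergence.\<close>

lemma op_comp_local_bound:
  assumes E: "op_bound E M" and D: "op_bound D L" and G: "finite G"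
    and t: "ell2_norm (proj (- ((\<lambda>g. g + y) ` G)) (D (ket y))) \<le> e1"
    and s: "\<And>g. g \<in> G \<Longrightarrow> ell2_norm (E (ket (g + y))) \<le> e2" and e2: "0 \<le> e2"
  shows "ell2_norm (E (D (ket y))) \<le> M * e1 + real (card G) * (L * e2)"
proof -
  let ?S = "(\<lambda>g. g + y) ` G"
  have "(\<Sum>s\<in>?S. cmod (D (ket y) s) * ell2_norm (E (ket s))) \<le> of_nat (card ?S) * (L * e2)"
    using op_bound_ket(2)[OF D] s op_boundD(1)[OF D]
    by (intro sum_bounded_above mult_mono) auto
  also have "\<dots> \<le> real (card G) * (L * e2)"
    using card_image_le[OF G, of "\<lambda>g. g + y"] e2 op_boundD(1)[OF D]
    by (intro mult_right_mono) auto
  finally show ?thesis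
    using op_bound_apply_proj[OF E op_boundD(2)[OF D ket_ell2(1)], of ?S y] G
      mult_left_mono[OF t op_boundD(1)[OF E]] by simp
qed

lemma local_op_Lsh: "local_op (Lsh r)"
  unfolding local_op_def
proof (intro allI impI exI[of _ "{r}"] conjI)
  fix \<epsilon> :: real and y assume "0 < \<epsilon>"
  have "proj (- ((\<lambda>g. g + y) ` {r})) (Lsh r (ket y)) = 0"
  proof
    fix t show "proj (- ((\<lambda>g. g + y) ` {r})) (Lsh r (ket y)) t = 0 t"
      by (auto simp: proj_def Lsh_def ket_def)
  qed
  then show "ell2_norm (proj (- ((\<lambda>g. g + y) ` {r})) (Lsh r (ket y))) \<le> \<epsilon>"
    using \<open>0 < \<epsilon>\<close> by (metis ell2_zero(2) less_imp_le)
qed simp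

lemma local_op_mult: "local_op (mult_op a)"
  unfolding local_op_def
proof (intro allI impI exI[of _ "{0}"] conjI)
  fix \<epsilon> :: real and y :: 'a assume "0 < \<epsilon>"
  have "proj (- ((\<lambda>g. g + y) ` {0})) (mult_op a (ket y)) = 0"
    by (auto simp: fun_eq_iff proj_def mult_op_def ket_def)
  then show "ell2_norm (proj (- ((\<lambda>g. g + y) ` {0})) (mult_op a (ket y))) \<le> \<epsilon>"
    using \<open>0 < \<epsilon>\<close> by (metis ell2_zero(2) less_imp_le)
qed simp

lemma local_op_plus:
  assumes "local_op B" "local_op C" "op_bound B K" "op_bound C L"
  shows "local_op (\<lambda>u. B u + C u)"
  unfolding local_op_def
proof (intro allI impI)
  fix \<epsilon> :: real assume "0 < \<epsilon>"
  then have e: "0 < \<epsilon>/2" by simp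
  obtain G where G: "finite G" "\<And>y. ell2_norm (proj (- ((\<lambda>g. g + y) ` G)) (B (ket y))) \<le> \<epsilon>/2"
    by (rule local_opD[OF assms(1) e]) blast
  obtain H where H: "finite H" "\<And>y. ell2_norm (proj (- ((\<lambda>g. g + y) ` H)) (C (ket y))) \<le> \<epsilon>/2"
    by (rule local_opD[OF assms(2) e]) blast
  show "\<exists>G. finite G \<and> (\<forall>y. ell2_norm (proj (- ((\<lambda>g. g + y) ` G)) (B (ket y) + C (ket y))) \<le> \<epsilon>)"
  proof (intro exI[of _ "G \<union> H"] conjI allI)
    fix y
    let ?X = "- ((\<lambda>g. g + y) ` (G \<union> H))"
    have m: "B (ket y) \<in> ell2" "C (ket y) \<in> ell2"
      using op_boundD(2)[OF assms(3)] op_boundD(2)[OF assms(4)] by auto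
    have "ell2_norm (proj ?X (B (ket y))) \<le> \<epsilon>/2"
      by (rule order_trans[OF ell2_norm_proj_mono G(2)[of y]]) (use m in auto)
    moreover have "ell2_norm (proj ?X (C (ket y))) \<le> \<epsilon>/2"
      by (rule order_trans[OF ell2_norm_proj_mono H(2)[of y]]) (use m in auto)
    ultimately show "ell2_norm (proj ?X (B (ket y) + C (ket y))) \<le> \<epsilon>"
      unfolding op_boundD(3)[OF op_bound_proj m]
      using ell2_add(2)[OF proj_ell2(1)[OF m(1)] proj_ell2(1)[OF m(2)], of ?X ?X] by linarith
  qed (use G H in auto)
qed

lemma local_op_comp:
  assumes "local_op B" "local_op D" and B: "op_bound B K" and D: "op_bound D L"
  shows "local_op (B \<circ> D)"
  unfolding local_op_def
proof (intro allI impI)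
  fix \<epsilon> :: real assume e: "0 < \<epsilon>"
  have K: "0 \<le> K" and L: "0 \<le> L" using op_boundD(1) B D by auto
  have e1: "0 < \<epsilon> / (2 * (K + 1))" using e K by simp
  obtain G where G: "finite G"
    "\<And>y. ell2_norm (proj (- ((\<lambda>g. g + y) ` G)) (D (ket y))) \<le> \<epsilon> / (2 * (K + 1))"
    by (rule local_opD[OF assms(2) e1]) blast
  \<comment> \<open>The accuracy demanded of \<open>B\<close> depends on the number of points in
    \<open>G\<close> and can be fixed only now.\<close>
  define e2 where "e2 = \<epsilon> / (2 * (real (card G) * L + 1))"
  have pos: "0 < real (card G) * L + 1" using L by (simp add: add_nonneg_pos)
  have e2: "0 < e2" unfolding e2_def using e pos by simp
  obtain H where H: "finite H" "\<And>y. ell2_norm (proj (- ((\<lambda>g. g + y) ` H)) (B (ket y))) \<le> e2"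
    by (rule local_opD[OF assms(1) e2]) blast
  \<comment> \<open>Two successive displacements: by \<open>g\<close> under \<open>D\<close>, then
    by \<open>h\<close> under \<open>B\<close>.\<close>
  define S where "S = (\<lambda>(h, g). h + g) ` (H \<times> G)"
  have "ell2_norm (proj (- ((\<lambda>g. g + y) ` S)) (B (D (ket y)))) \<le> \<epsilon>" for y
  proof -
    let ?P = "proj (- ((\<lambda>g. g + y) ` S))"
    have E: "op_bound (?P \<circ> B) (1 * K)" by (rule op_bound_comp[OF op_bound_proj B])
    have "ell2_norm ((?P \<circ> B) (ket (g + y))) \<le> e2" if "g \<in> G" for g
    proof -
      have "(\<lambda>h. h + (g + y)) ` H \<subseteq> (\<lambda>g. g + y) ` S"
        using that by (force simp: S_def add.assoc)
      then show ?thesis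
        using order_trans[OF ell2_norm_proj_mono H(2)[of "g + y"]] op_boundD(2)[OF B ket_ell2(1)] by auto
    qed
    from op_comp_local_bound[OF E D G(1) G(2) this]
    have "ell2_norm (?P (B (D (ket y)))) \<le> K * (\<epsilon> / (2 * (K + 1))) + real (card G) * (L * e2)"
      using e2 by simp
    also have "K * (\<epsilon> / (2 * (K + 1))) \<le> (K + 1) * (\<epsilon> / (2 * (K + 1)))"
      using e1 by (intro mult_right_mono) auto
    also have "\<dots> = \<epsilon>/2" using K by (simp add: field_simps)
    also have "real (card G) * (L * e2) \<le> (real (card G) * L + 1) * e2"
      using e2 by (simp add: algebra_simps)
    also have "\<dots> = \<epsilon>/2" using pos by (simp add: e2_def field_simps)
    finally show ?thesis by simp
  qed
  moreover have "finite S" using G H by (simp add: S_def)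
  ultimately show "\<exists>G. finite G \<and> (\<forall>y. ell2_norm (proj (- ((\<lambda>g. g + y) ` G)) ((B \<circ> D) (ket y))) \<le> \<epsilon>)"
    by auto
qed

text \<open>Cutting off is a contraction, so the finite set of an approximant serves
  \<open>B\<close> as well, at the cost of the approximation error.\<close>

lemma local_op_limit:
  assumes B: "op_bound B K"
    and "\<And>\<epsilon>. 0 < \<epsilon> \<Longrightarrow> \<exists>C L. op_bound C L \<and> local_op C \<and> (\<forall>u\<in>ell2. ell2_norm (B u - C u) \<le> \<epsilon> * ell2_norm u)"
  shows "local_op B"
  unfolding local_op_def
proof (intro allI impI)
  fix \<epsilon> :: real assume "0 < \<epsilon>"
  then have e: "0 < \<epsilon>/2" by simp
  then obtain C L where C: "op_bound C L" "local_op C"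
    and d: "\<And>u. u \<in> ell2 \<Longrightarrow> ell2_norm (B u - C u) \<le> \<epsilon>/2 * ell2_norm u" using assms(2) by blast
  obtain G where G: "finite G" "\<And>y. ell2_norm (proj (- ((\<lambda>g. g + y) ` G)) (C (ket y))) \<le> \<epsilon>/2"
    by (rule local_opD[OF C(2) e]) blast
  have "ell2_norm (proj (- ((\<lambda>g. g + y) ` G)) (B (ket y))) \<le> \<epsilon>" for y
  proof -
    let ?P = "proj (- ((\<lambda>g. g + y) ` G))"
    have m: "B (ket y) \<in> ell2" "C (ket y) \<in> ell2"
      using op_boundD(2)[OF B] op_boundD(2)[OF C(1)] by auto
    have "ell2_norm (?P (B (ket y)) - ?P (C (ket y))) \<le> ell2_norm (B (ket y) - C (ket y))"
      using proj_ell2(2)[OF ell2_diff(1)[OF m]] unfolding op_bound_diff[OF op_bound_proj m] .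
    also have "\<dots> \<le> \<epsilon>/2 * 1"
      by (rule order_trans[OF d mult_left_mono]) (use e in auto)
    finally show ?thesis
      using ell2_norm_le_add_diff[OF proj_ell2(1)[OF m(1), of "- ((\<lambda>g. g + y) ` G)"]
          proj_ell2(1)[OF m(2), of "- ((\<lambda>g. g + y) ` G)"]] G(2)[of y]
      by linarith
  qed
  with G show "\<exists>G. finite G \<and> (\<forall>y. ell2_norm (proj (- ((\<lambda>g. g + y) ` G)) (B (ket y))) \<le> \<epsilon>)" by auto
qed

lemma mult_op_const: "mult_op (\<lambda>_. c) u = (\<lambda>t. c * u t)"
  by (simp add: mult_op_def)

text \<open>Scaling is composition with a constant multiplication operator, so the case of products
  applies.\<close>

lemma local_op_cmult:
  assumes "local_op B" "op_bound B K"
  shows "local_op (\<lambda>u t. c * B u t)"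
proof -
  have "op_bound (mult_op (\<lambda>_::'a. c)) (cmod c)" by (rule op_bound_mult) simp
  from local_op_comp[OF local_op_mult assms(1) this assms(2)]
  show ?thesis by (simp add: comp_def mult_op_const)
qed

section \<open>Locality and adjoints in BDO\<close>

lemma bdo_gen_local:
  assumes "C \<in> bdo_gen"
  shows "\<exists>K. op_bound C K \<and> local_op C"
  using assms
proof induction
  case (shift r)
  show ?case using op_bound_translate(2) local_op_Lsh by blast
next
  case (mult a)
  then show ?case using op_bound_mult local_op_mult unfolding bounded_fun_def by blast
next
  case (add B C)
  then show ?case using op_bound_plus local_op_plus by metis
next
  case (smult B c)
  then show ?case using op_bound_cmult local_op_cmult by metis
next
  case (comp B C)
  then show ?case using op_bound_comp local_op_comp by metis
qed

text \<open>No rule of \<open>bdo_gen\<close> mentions adjoints, but the generators are permuted by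
  them: shifts are inverted and multipliers conjugated; sums, multiples and products follow.\<close>

lemma bdo_gen_adj:
  assumes "C \<in> bdo_gen"
  shows "\<exists>C'\<in>bdo_gen. is_adj C C'"
  using assms
proof induction
  case (shift r)
  show ?case using is_adj_Lsh bdo_gen.shift by blast
next
  case (mult a)
  then have "bounded_fun (\<lambda>t. cnj (a t))" by (simp add: bounded_fun_def)
  then show ?case using is_adj_mult[OF mult] bdo_gen.mult by blast
next
  case (add B C)
  then show ?case using bdo_gen_local is_adj_plus bdo_gen.add by metis
next
  case (smult B c)
  then show ?case using is_adj_cmult bdo_gen.smult by metis
next
  case (comp B C)
  then show ?case using bdo_gen_local is_adj_comp bdo_gen.comp by metis
qed

text \<open>Locality speaks of columns only, so it has to be established separately for
  \<open>B'\<close>: the adjoints of the approximants are again in \<open>bdo_gen\<close>, hence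
  local, and approximate \<open>B'\<close> equally well.\<close>

lemma BDO_local:
  assumes "B \<in> BDO"
  shows "\<exists>K B'. op_bound B K \<and> is_adj B B' \<and> local_op B \<and> local_op B'"
proof -
  obtain K where K: "op_bound B K" using assms bounded_op_iff unfolding BDO_def by blast
  then obtain B' where B': "is_adj B B'" using is_adj_exists by blast
  have ap: "\<exists>C\<in>bdo_gen. \<forall>u\<in>ell2. ell2_norm (B u - C u) \<le> \<epsilon> * ell2_norm u" if "0 < \<epsilon>" for \<epsilon>
    using assms that by (auto simp: BDO_def)
  have "local_op B"
    by (rule local_op_limit[OF K]) (meson ap bdo_gen_local)
  moreover have "local_op B'"
  proof (rule local_op_limit[OF is_adj_op_bound[OF K B']])
    fix \<epsilon> :: real assume e: "0 < \<epsilon>"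
    obtain C where C: "C \<in> bdo_gen" "\<And>u. u \<in> ell2 \<Longrightarrow> ell2_norm (B u - C u) \<le> \<epsilon> * ell2_norm u"
      using ap[OF e] by blast
    obtain L where L: "op_bound C L" using bdo_gen_local[OF C(1)] by blast
    obtain C' where C': "C' \<in> bdo_gen" "is_adj C C'" using bdo_gen_adj[OF C(1)] by blast
    have "ell2_norm (B' u - C' u) \<le> \<epsilon> * ell2_norm u" if "u \<in> ell2" for u
      by (rule is_adj_diff_norm[OF B' C'(2) K L]) (use e C that in auto)
    then show "\<exists>C L. op_bound C L \<and> local_op C \<and> (\<forall>u\<in>ell2. ell2_norm (B' u - C u) \<le> \<epsilon> * ell2_norm u)"
      using bdo_gen_local[OF C'(1)] by blast
  qed
  ultimately show ?thesis using K B' by blast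
qed

section \<open>Deep convergence of compressions, sums, products and norm limits\<close>

lemma deep_conv_compression:
  assumes B: "op_bound B K" and "local_op B"
  shows "deep_conv Y (\<lambda>n. proj (Y n) \<circ> B \<circ> proj (Y n)) B"
  unfolding deep_conv_def
proof (intro allI impI)
  fix \<epsilon> :: real assume e: "0 < \<epsilon>"
  obtain G where G: "finite G" "\<And>y. ell2_norm (proj (- ((\<lambda>g. g + y) ` G)) (B (ket y))) \<le> \<epsilon>"
    by (rule local_opD[OF assms(2) e]) blast
  \<comment> \<open>Adding 0 to \<open>G\<close> puts \<open>y\<close> itself into
    \<open>Y k\<close>, so that the inner projection fixes \<open>ket y\<close>.\<close>
  have "ell2_norm ((proj (Y k) \<circ> B \<circ> proj (Y k)) (ket y) - B (ket y)) \<le> \<epsilon>"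
    if "(\<lambda>g. g + y) ` (insert 0 G) \<subseteq> Y k" for k y
  proof -
    have "y \<in> Y k" using that by auto
    then have "proj (Y k) (ket y) = ket y" by (auto simp: fun_eq_iff proj_def ket_def)
    moreover have "B (ket y) - proj (Y k) (B (ket y)) = proj (- Y k) (B (ket y))"
      by (auto simp: fun_eq_iff proj_def)
    moreover have "ell2_norm (proj (- Y k) (B (ket y))) \<le> \<epsilon>"
      by (rule order_trans[OF ell2_norm_proj_mono G(2)[of y]]) (use that op_boundD(2)[OF B] in auto)
    ultimately show ?thesis by (subst ell2_norm_minus_commute) simp
  qed
  with G show "\<exists>G. finite G \<and> (\<forall>k y. (\<lambda>g. g + y) ` G \<subseteq> Y k \<longrightarrow>
     ell2_norm ((proj (Y k) \<circ> B \<circ> proj (Y k)) (ket y) - B (ket y)) \<le> \<epsilon>)"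
    by (intro exI[of _ "insert 0 G"]) auto
qed

lemma deep_conv_plus:
  assumes "deep_conv Y a B" "deep_conv Y c D" "\<And>n. op_bound (a n) K" "\<And>n. op_bound (c n) L"
    "op_bound B K" "op_bound D L"
  shows "deep_conv Y (\<lambda>n u. a n u + c n u) (\<lambda>u. B u + D u)"
  unfolding deep_conv_def
proof (intro allI impI)
  fix \<epsilon> :: real assume "0 < \<epsilon>"
  then have e: "0 < \<epsilon>/2" by simp
  obtain G where G: "finite G" "\<And>k y. (\<lambda>g. g + y) ` G \<subseteq> Y k \<Longrightarrow> ell2_norm (a k (ket y) - B (ket y)) \<le> \<epsilon>/2"
    by (rule deep_convD[OF assms(1) e]) blast
  obtain H where H: "finite H" "\<And>k y. (\<lambda>g. g + y) ` H \<subseteq> Y k \<Longrightarrow> ell2_norm (c k (ket y) - D (ket y)) \<le> \<epsilon>/2"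
    by (rule deep_convD[OF assms(2) e]) blast
  have "ell2_norm ((a k (ket y) + c k (ket y)) - (B (ket y) + D (ket y))) \<le> \<epsilon>"
    if "(\<lambda>g. g + y) ` (G \<union> H) \<subseteq> Y k" for k y
  proof -
    have "(a k (ket y) + c k (ket y)) - (B (ket y) + D (ket y))
      = (a k (ket y) - B (ket y)) + (c k (ket y) - D (ket y))" by simp
    moreover have "a k (ket y) - B (ket y) \<in> ell2" "c k (ket y) - D (ket y) \<in> ell2"
      using assms(3-6) op_boundD(2) ket_ell2(1) ell2_diff(1) by metis+
    ultimately have "ell2_norm ((a k (ket y) + c k (ket y)) - (B (ket y) + D (ket y)))
      \<le> ell2_norm (a k (ket y) - B (ket y)) + ell2_norm (c k (ket y) - D (ket y))"
      using ell2_add(2) by metis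
    moreover have "ell2_norm (a k (ket y) - B (ket y)) \<le> \<epsilon>/2" "ell2_norm (c k (ket y) - D (ket y)) \<le> \<epsilon>/2"
      using G(2) H(2) that by blast+
    ultimately show ?thesis by linarith
  qed
  with G H show "\<exists>G. finite G \<and> (\<forall>k y. (\<lambda>g. g + y) ` G \<subseteq> Y k \<longrightarrow>
     ell2_norm ((a k (ket y) + c k (ket y)) - (B (ket y) + D (ket y))) \<le> \<epsilon>)"
    by (intro exI[of _ "G \<union> H"]) auto
qed

lemma deep_conv_cmult:
  assumes "deep_conv Y a B"
  shows "deep_conv Y (\<lambda>n u t. c * a n u t) (\<lambda>u t. c * B u t)"
  unfolding deep_conv_def
proof (intro allI impI)
  fix \<epsilon> :: real assume e: "0 < \<epsilon>"
  then have e1: "0 < \<epsilon> / (cmod c + 1)" by (simp add: add_nonneg_pos)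
  obtain G where G: "finite G" "\<And>k y. (\<lambda>g. g + y) ` G \<subseteq> Y k \<Longrightarrow> ell2_norm (a k (ket y) - B (ket y)) \<le> \<epsilon> / (cmod c + 1)"
    by (rule deep_convD[OF assms e1]) blast
  have "ell2_norm ((\<lambda>t. c * a k (ket y) t) - (\<lambda>t. c * B (ket y) t)) \<le> \<epsilon>"
    if "(\<lambda>g. g + y) ` G \<subseteq> Y k" for k y
  proof -
    have "(\<lambda>t. c * a k (ket y) t) - (\<lambda>t. c * B (ket y) t) = (\<lambda>t. c * (a k (ket y) - B (ket y)) t)"
      by (simp add: fun_eq_iff algebra_simps)
    then have "ell2_norm ((\<lambda>t. c * a k (ket y) t) - (\<lambda>t. c * B (ket y) t))
      = cmod c * ell2_norm (a k (ket y) - B (ket y))" using ell2_norm_cmult by metis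
    also have "\<dots> \<le> (cmod c + 1) * (\<epsilon> / (cmod c + 1))"
      using G(2)[OF that] by (intro mult_mono) auto
    also have "\<dots> = \<epsilon>" by (simp add: add_nonneg_eq_0_iff)
    finally show ?thesis .
  qed
  with G show "\<exists>G. finite G \<and> (\<forall>k y. (\<lambda>g. g + y) ` G \<subseteq> Y k \<longrightarrow>
     ell2_norm ((\<lambda>t. c * a k (ket y) t) - (\<lambda>t. c * B (ket y) t)) \<le> \<epsilon>)" by blast
qed

text \<open>Write \<open>a c - B D\<close> as \<open>a (c - D) + (a - B) D\<close>. In the second
  term \<open>D (ket y)\<close> is essentially carried by the points \<open>g + y\<close>; these are
  deep enough for \<open>a - B\<close> once the products \<open>h + g\<close> are included in the
  finite set.\<close>

lemma deep_conv_comp: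
  assumes "deep_conv Y a B" "deep_conv Y c D" and a: "\<And>n. op_bound (a n) K" and c: "\<And>n. op_bound (c n) L"
    and B: "op_bound B K" and D: "op_bound D L" and "local_op D"
  shows "deep_conv Y (\<lambda>n. a n \<circ> c n) (B \<circ> D)"
  unfolding deep_conv_def
proof (intro allI impI)
  fix \<epsilon> :: real assume e: "0 < \<epsilon>"
  have K: "0 \<le> K" and L: "0 \<le> L" using op_boundD(1) B D by auto
  \<comment> \<open>The accuracy \<open>e1\<close> is multiplied by \<open>K\<close> three times:
    twice through the bound \<open>K + K\<close> of \<open>a k - B\<close>, once through
    \<open>a k\<close>. As \<open>3 * K \<le> 2 * (2 * K + 1)\<close>, this costs two thirds of
    \<epsilon>.\<close>
  define e1 where "e1 = \<epsilon> / (3 * (2 * K + 1))"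
  have e1: "0 < e1" using e K by (simp add: e1_def)
  obtain G where G: "finite G" "\<And>y. ell2_norm (proj (- ((\<lambda>g. g + y) ` G)) (D (ket y))) \<le> e1"
    by (rule local_opD[OF assms(7) e1]) blast
  define e2 where "e2 = \<epsilon> / (3 * (real (card G) * L + 1))"
  have pos: "0 < real (card G) * L + 1" using L by (simp add: add_nonneg_pos)
  have e2: "0 < e2" unfolding e2_def using e pos by simp
  obtain H where H: "finite H" "\<And>k y. (\<lambda>g. g + y) ` H \<subseteq> Y k \<Longrightarrow> ell2_norm (a k (ket y) - B (ket y)) \<le> e2"
    by (rule deep_convD[OF assms(1) e2]) blast
  obtain J where J: "finite J" "\<And>k y. (\<lambda>g. g + y) ` J \<subseteq> Y k \<Longrightarrow> ell2_norm (c k (ket y) - D (ket y)) \<le> e1"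
    by (rule deep_convD[OF assms(2) e1]) blast
  define S where "S = J \<union> (\<lambda>(h, g). h + g) ` (H \<times> G)"
  have "ell2_norm ((a k \<circ> c k) (ket y) - (B \<circ> D) (ket y)) \<le> \<epsilon>" if S: "(\<lambda>g. g + y) ` S \<subseteq> Y k" for k y
  proof -
    have E: "op_bound (\<lambda>u. a k u - B u) (K + K)" by (rule op_bound_minus[OF a B])
    have "ell2_norm (a k (ket (g + y)) - B (ket (g + y))) \<le> e2" if "g \<in> G" for g
    proof (rule H(2))
      have "(\<lambda>h. h + (g + y)) ` H \<subseteq> (\<lambda>g. g + y) ` S"
        using that by (force simp: S_def add.assoc)
      then show "(\<lambda>h. h + (g + y)) ` H \<subseteq> Y k" using S by blast
    qed
    from op_comp_local_bound[OF E D G(1) G(2) this]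
    have 1: "ell2_norm (a k (D (ket y)) - B (D (ket y))) \<le> (K + K) * e1 + real (card G) * (L * e2)"
      using e2 by (simp add: fun_diff_def)
    have m: "c k (ket y) \<in> ell2" "D (ket y) \<in> ell2"
      using op_boundD(2)[OF c] op_boundD(2)[OF D] by auto
    have "ell2_norm (a k (c k (ket y)) - a k (D (ket y))) \<le> K * ell2_norm (c k (ket y) - D (ket y))"
      using op_boundD(5)[OF a ell2_diff(1)[OF m]] unfolding op_bound_diff[OF a m] .
    also have "\<dots> \<le> K * e1" using K J(2)[of y k] S by (intro mult_left_mono) (auto simp: S_def)
    finally have 2: "ell2_norm (a k (c k (ket y)) - a k (D (ket y))) \<le> K * e1" .
    have "ell2_norm (a k (c k (ket y)) - B (D (ket y))) \<le> 3 * K * e1 + real (card G) * (L * e2)"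
      using ell2_norm_triangle_sub[of "a k (c k (ket y))" "a k (D (ket y))" "B (D (ket y))"] 1 2
        op_boundD(2)[OF a] op_boundD(2)[OF B] m by (simp add: algebra_simps)
    also have "3 * K * e1 \<le> 2 * ((2 * K + 1) * e1)" using e1 K by (simp add: algebra_simps)
    also have "(2 * K + 1) * e1 = \<epsilon>/3" using K by (simp add: e1_def field_simps)
    also have "real (card G) * (L * e2) \<le> (real (card G) * L + 1) * e2"
      using e2 by (simp add: algebra_simps)
    also have "\<dots> = \<epsilon>/3" using pos by (simp add: e2_def field_simps)
    finally show ?thesis by (simp add: fun_diff_def)
  qed
  moreover have "finite S" using G H J by (simp add: S_def)
  ultimately show "\<exists>G. finite G \<and> (\<forall>k y. (\<lambda>g. g + y) ` G \<subseteq> Y k \<longrightarrow>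
     ell2_norm ((a k \<circ> c k) (ket y) - (B \<circ> D) (ket y)) \<le> \<epsilon>)" by blast
qed

text \<open>An approximation uniform in \<open>n\<close> changes every column by at most a third of
  \<epsilon>, wherever \<open>y\<close> is, so the finite set of the approximant can be
  kept.\<close>

lemma deep_conv_limit:
  assumes a: "\<And>n. op_bound (a n) K" and B: "op_bound B L"
    and ap: "\<And>\<epsilon>. 0 < \<epsilon> \<Longrightarrow> \<exists>c D M. (\<forall>n. op_bound (c n) M) \<and> op_bound D M \<and> deep_conv Y c D
      \<and> (\<forall>n. \<forall>u\<in>ell2. ell2_norm (a n u - c n u) \<le> \<epsilon> * ell2_norm u)
      \<and> (\<forall>u\<in>ell2. ell2_norm (B u - D u) \<le> \<epsilon> * ell2_norm u)"
  shows "deep_conv Y a B"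
  unfolding deep_conv_def
proof (intro allI impI)
  fix \<epsilon> :: real assume "0 < \<epsilon>"
  then have e: "0 < \<epsilon>/3" by simp
  then obtain c D M where c: "\<And>n. op_bound (c n) M" and D: "op_bound D M" and d: "deep_conv Y c D"
    and ac: "\<And>n u. u \<in> ell2 \<Longrightarrow> ell2_norm (a n u - c n u) \<le> \<epsilon>/3 * ell2_norm u"
    and BD: "\<And>u. u \<in> ell2 \<Longrightarrow> ell2_norm (B u - D u) \<le> \<epsilon>/3 * ell2_norm u" using ap[OF e] by blast
  obtain G where G: "finite G" "\<And>k y. (\<lambda>g. g + y) ` G \<subseteq> Y k \<Longrightarrow> ell2_norm (c k (ket y) - D (ket y)) \<le> \<epsilon>/3"
    by (rule deep_convD[OF d e]) blast
  have "ell2_norm (a k (ket y) - B (ket y)) \<le> \<epsilon>" if "(\<lambda>g. g + y) ` G \<subseteq> Y k" for k y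
  proof -
    have m: "a k (ket y) \<in> ell2" "c k (ket y) \<in> ell2" "D (ket y) \<in> ell2" "B (ket y) \<in> ell2"
      using op_boundD(2)[OF a] op_boundD(2)[OF c] op_boundD(2)[OF D] op_boundD(2)[OF B] by auto
    have k: "\<epsilon>/3 * ell2_norm (ket y) \<le> \<epsilon>/3"
      using mult_left_mono[OF ket_ell2(2), of "\<epsilon>/3" y] e by simp
    have "ell2_norm (a k (ket y) - c k (ket y)) \<le> \<epsilon>/3" "ell2_norm (D (ket y) - B (ket y)) \<le> \<epsilon>/3"
      using ac[of "ket y" k] BD[of "ket y"] k ell2_norm_minus_commute[of "D (ket y)" "B (ket y)"] by auto
    then show ?thesis
      using ell2_norm_triangle_sub[OF m(1,2,4)] ell2_norm_triangle_sub[OF m(2,3,4)] G(2)[OF that] by linarith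
  qed
  with G show "\<exists>G. finite G \<and> (\<forall>k y. (\<lambda>g. g + y) ` G \<subseteq> Y k \<longrightarrow> ell2_norm (a k (ket y) - B (ket y)) \<le> \<epsilon>)"
    by blast
qed

subsection \<open>The algebra of sequences\<close>

text \<open>The invariant preserved by all operations of the algebra. Both limits have to be local:
  a product needs locality of the limit of its right factor, and passing to adjoints reverses the
  order of the factors.\<close>

definition stable_limit :: "(nat \<Rightarrow> 'g::group_add set) \<Rightarrow> (nat \<Rightarrow> 'g op) \<Rightarrow> 'g op \<Rightarrow> bool" where
  "stable_limit Y a B \<longleftrightarrow> (\<exists>K a' B'. (\<forall>n. op_bound (a n) K) \<and> op_bound B K
     \<and> (\<forall>n. is_adj (a n) (a' n)) \<and> is_adj B B'
     \<and> local_op B \<and> local_op B' \<and> deep_conv Y a B \<and> deep_conv Y a' B')"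

text \<open>Allows projections to be inserted between the factors of a product, and later confines
  each block to its own coordinates.\<close>

definition compressed :: "(nat \<Rightarrow> 'g set) \<Rightarrow> (nat \<Rightarrow> 'g op) \<Rightarrow> bool" where
  "compressed Y a \<longleftrightarrow> (\<forall>n. \<forall>u\<in>ell2. proj (Y n) (a n u) = a n u \<and> a n (proj (Y n) u) = a n u)"

lemma proj_proj [simp]: "proj X (proj X u) = proj X u"
  by (auto simp: proj_def)

lemma proj_plus: "proj X (u + w) = proj X u + proj X w"
  by (auto simp: proj_def fun_eq_iff)

lemma proj_cmult: "proj X (\<lambda>t. c * u t) = (\<lambda>t. c * proj X u t)"
  by (auto simp: proj_def fun_eq_iff)

lemma exhaustion_finite_subset:
  fixes Y :: "nat \<Rightarrow> 'g set"
  assumes Y_mono: "\<forall>n. Y n \<subseteq> Y (Suc n)" and Y_union: "(\<Union>n. Y n) = UNIV" and "finite F"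
  shows "\<exists>N. \<forall>n\<ge>N. F \<subseteq> Y n"
  using assms(3)
proof (induction F rule: finite_induct)
  case (insert x F)
  obtain N where N: "\<forall>n\<ge>N. F \<subseteq> Y n" using insert by blast
  obtain M where M: "x \<in> Y M" using Y_union by blast
  have "insert x F \<subseteq> Y n" if "n \<ge> max M N" for n
    using lift_Suc_mono_le[of Y M n] Y_mono that M N by auto
  then show ?case by blast
qed simp

lemma deep_conv_cong:
  assumes "deep_conv Y a B" "\<And>n u. u \<in> ell2 \<Longrightarrow> c n u = a n u"
  shows "deep_conv Y c B"
  using assms unfolding deep_conv_def by simp

lemma stable_limit_cong:
  assumes "stable_limit Y a B" "\<And>n u. u \<in> ell2 \<Longrightarrow> c n u = a n u"
  shows "stable_limit Y c B"
proof -
  obtain K a' B' where *: "\<And>n. op_bound (a n) K" "op_bound B K" "\<And>n. is_adj (a n) (a' n)" "is_adj B B'"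
    "local_op B" "local_op B'" "deep_conv Y a B" "deep_conv Y a' B'"
    using assms(1) unfolding stable_limit_def by blast
  have "op_bound (c n) K" "is_adj (c n) (a' n)" for n
    using op_bound_cong[OF *(1) assms(2)] is_adj_cong[OF *(3) assms(2)] by auto
  then show ?thesis unfolding stable_limit_def using * deep_conv_cong[OF *(7) assms(2)] by blast
qed

lemma compressed_cong:
  assumes "compressed Y a" "\<And>n u. u \<in> ell2 \<Longrightarrow> c n u = a n u"
  shows "compressed Y c"
  using assms unfolding compressed_def by (simp add: proj_ell2)

lemma compressed_comp:
  assumes "compressed Y a" "compressed Y c" "\<And>n u. u \<in> ell2 \<Longrightarrow> c n u \<in> ell2"
  shows "compressed Y (\<lambda>n. a n \<circ> c n)"
  using assms unfolding compressed_def by simp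

lemma stable_limit_compression:
  fixes B :: "'g::group_add op"
  assumes "B \<in> BDO"
  shows "stable_limit Y (\<lambda>n. proj (Y n) \<circ> B \<circ> proj (Y n)) B"
proof -
  obtain K B' where B: "op_bound B K" "is_adj B B'" "local_op B" "local_op B'"
    using BDO_local[OF assms] by blast
  have "op_bound (proj (Y n) \<circ> B \<circ> proj (Y n)) K" for n
    using op_bound_comp[OF op_bound_comp[OF op_bound_proj B(1)] op_bound_proj, of "Y n" "Y n"] by simp
  moreover have "is_adj (proj (Y n) \<circ> B \<circ> proj (Y n)) (proj (Y n) \<circ> B' \<circ> proj (Y n))" for n
    using is_adj_comp[OF is_adj_comp[OF is_adj_proj B(2) B(1)] is_adj_proj op_bound_proj, of "Y n" "Y n"]
    by (simp add: comp_assoc)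
  ultimately show ?thesis unfolding stable_limit_def
    using B deep_conv_compression[OF B(1,3), of Y] deep_conv_compression[OF is_adj_op_bound[OF B(1,2)] B(4), of Y]
    by (intro exI[of _ K] exI[of _ "\<lambda>n. proj (Y n) \<circ> B' \<circ> proj (Y n)"] exI[of _ B']) simp
qed

lemma stable_limit_plus:
  assumes "stable_limit Y a B" "stable_limit Y c D"
  shows "stable_limit Y (\<lambda>n u. a n u + c n u) (\<lambda>u. B u + D u)"
proof -
  obtain K a' B' where a: "\<And>n. op_bound (a n) K" "op_bound B K" "\<And>n. is_adj (a n) (a' n)" "is_adj B B'"
    "local_op B" "local_op B'" "deep_conv Y a B" "deep_conv Y a' B'"
    using assms(1) unfolding stable_limit_def by blast
  obtain L c' D' where c: "\<And>n. op_bound (c n) L" "op_bound D L" "\<And>n. is_adj (c n) (c' n)" "is_adj D D'"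
    "local_op D" "local_op D'" "deep_conv Y c D" "deep_conv Y c' D'"
    using assms(2) unfolding stable_limit_def by blast
  have a': "\<And>n. op_bound (a' n) K" "op_bound B' K" and c': "\<And>n. op_bound (c' n) L" "op_bound D' L"
    using a c is_adj_op_bound by blast+
  show ?thesis unfolding stable_limit_def
    by (intro exI[of _ "K + L"] exI[of _ "\<lambda>n u. a' n u + c' n u"] exI[of _ "\<lambda>u. B' u + D' u"] conjI allI)
      (rule op_bound_plus is_adj_plus local_op_plus deep_conv_plus; fact a c a' c')+
qed

lemma stable_limit_cmult:
  assumes "stable_limit Y a B"
  shows "stable_limit Y (\<lambda>n u t. c * a n u t) (\<lambda>u t. c * B u t)"
proof -
  obtain K a' B' where a: "\<And>n. op_bound (a n) K" "op_bound B K" "\<And>n. is_adj (a n) (a' n)" "is_adj B B'"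
    "local_op B" "local_op B'" "deep_conv Y a B" "deep_conv Y a' B'"
    using assms(1) unfolding stable_limit_def by blast
  have a': "\<And>n. op_bound (a' n) K" "op_bound B' K"
    using a is_adj_op_bound by blast+
  show ?thesis unfolding stable_limit_def
    by (intro exI[of _ "cmod c * K"] exI[of _ "\<lambda>n u t. cnj c * a' n u t"] exI[of _ "\<lambda>u t. cnj c * B' u t"] conjI allI)
      (rule op_bound_cmult is_adj_cmult local_op_cmult deep_conv_cmult; fact a a')+
qed

lemma stable_limit_comp:
  assumes "stable_limit Y a B" "stable_limit Y c D"
  shows "stable_limit Y (\<lambda>n. a n \<circ> c n) (B \<circ> D)"
proof -
  obtain K a' B' where a: "\<And>n. op_bound (a n) K" "op_bound B K" "\<And>n. is_adj (a n) (a' n)" "is_adj B B'"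
    "local_op B" "local_op B'" "deep_conv Y a B" "deep_conv Y a' B'"
    using assms(1) unfolding stable_limit_def by blast
  obtain L c' D' where c: "\<And>n. op_bound (c n) L" "op_bound D L" "\<And>n. is_adj (c n) (c' n)" "is_adj D D'"
    "local_op D" "local_op D'" "deep_conv Y c D" "deep_conv Y c' D'"
    using assms(2) unfolding stable_limit_def by blast
  have a': "\<And>n. op_bound (a' n) K" "op_bound B' K" and c': "\<And>n. op_bound (c' n) L" "op_bound D' L"
    using a c is_adj_op_bound by blast+
  show ?thesis unfolding stable_limit_def
    by (intro exI[of _ "K * L"] exI[of _ "\<lambda>n. c' n \<circ> a' n"] exI[of _ "D' \<circ> B'"] conjI allI)
      (rule op_bound_comp is_adj_comp local_op_comp deep_conv_comp; fact a c a' c')+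
qed

text \<open>The invariant is symmetric in a sequence and its adjoints, and a given choice
  \<open>a'\<close> agrees on \<open>ell2\<close> with the one recorded in it.\<close>

lemma stable_limit_adj:
  assumes "stable_limit Y a B" "\<And>n. is_adj (a n) (a' n)"
  obtains B' where "stable_limit Y a' B'"
proof -
  obtain K a'' B' where a: "\<And>n. op_bound (a n) K" "op_bound B K" "\<And>n. is_adj (a n) (a'' n)" "is_adj B B'"
    "local_op B" "local_op B'" "deep_conv Y a B" "deep_conv Y a'' B'"
    using assms(1) unfolding stable_limit_def by blast
  have "deep_conv Y a' B'"
    by (rule deep_conv_cong[OF a(8)]) (rule is_adj_unique[OF assms(2) a(3)])
  moreover have "op_bound (a' n) K" "op_bound B' K" "is_adj (a' n) (a n)" "is_adj B' B" for n
    using is_adj_op_bound[OF a(1) assms(2)] is_adj_op_bound[OF a(2,4)]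
      is_adj_sym[OF a(1) assms(2)] is_adj_sym[OF a(2,4)] by auto
  ultimately have "stable_limit Y a' B'" unfolding stable_limit_def using a by blast
  then show ?thesis by (rule that)
qed

text \<open>By uniqueness of adjoints, the projections that \<open>seq_gen\<close> puts around an
  adjoint change nothing for compressed entries.\<close>

lemma compressed_adj:
  assumes "compressed Y a" "\<And>n. is_adj (a n) (a' n)" "\<And>n. op_bound (a n) K" "u \<in> ell2"
  shows "(proj (Y n) \<circ> a' n \<circ> proj (Y n)) u = a' n u"
proof -
  have "is_adj (proj (Y n) \<circ> a n \<circ> proj (Y n)) (proj (Y n) \<circ> a' n \<circ> proj (Y n))"
    using is_adj_comp[OF is_adj_comp[OF is_adj_proj assms(2,3)] is_adj_proj op_bound_proj, of "Y n" n "Y n"]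
    by (simp add: comp_assoc)
  then have "is_adj (a n) (proj (Y n) \<circ> a' n \<circ> proj (Y n))"
    by (rule is_adj_cong) (use assms(1) in \<open>auto simp: compressed_def proj_ell2\<close>)
  then show ?thesis by (rule is_adj_unique[OF _ assms(2,4)])
qed

lemma seq_gen_stable:
  assumes "A \<in> seq_gen Y"
  shows "compressed Y (\<lambda>n. A n \<circ> proj (Y n)) \<and> (\<exists>B. stable_limit Y (\<lambda>n. A n \<circ> proj (Y n)) B)"
  using assms
proof induction
  case (gen B)
  have "(\<lambda>n. proj (Y n) \<circ> B \<circ> proj (Y n) \<circ> proj (Y n)) = (\<lambda>n. proj (Y n) \<circ> B \<circ> proj (Y n))"
    by (simp add: fun_eq_iff)
  then have "\<exists>D. stable_limit Y (\<lambda>n. proj (Y n) \<circ> B \<circ> proj (Y n) \<circ> proj (Y n)) D"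
    using stable_limit_compression[OF gen, of Y] by metis
  moreover have "compressed Y (\<lambda>n. proj (Y n) \<circ> B \<circ> proj (Y n) \<circ> proj (Y n))"
    by (simp add: compressed_def)
  ultimately show ?case by blast
next
  case (add A C)
  have "compressed Y (\<lambda>n. (\<lambda>u. A n u + C n u) \<circ> proj (Y n))"
    using add by (simp add: compressed_def proj_plus)
  then show ?case using add stable_limit_plus unfolding comp_def by blast
next
  case (smult A c)
  have "compressed Y (\<lambda>n. (\<lambda>u t. c * A n u t) \<circ> proj (Y n))"
    using smult by (simp add: compressed_def proj_cmult)
  then show ?case using smult stable_limit_cmult unfolding comp_def by blast
next
  case (comp A C)
  \<comment> \<open>\<open>C n\<close> maps the range of \<open>proj (Y n)\<close> into itself, so
    the projection between the two factors acts as the identity.\<close>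
  have e: "(A n \<circ> C n \<circ> proj (Y n)) u = ((\<lambda>n. (A n \<circ> proj (Y n)) \<circ> (C n \<circ> proj (Y n))) n) u" if "u \<in> ell2" for n u
    using comp that by (simp add: compressed_def)
  obtain B D where BD: "stable_limit Y (\<lambda>n. A n \<circ> proj (Y n)) B" "stable_limit Y (\<lambda>n. C n \<circ> proj (Y n)) D"
    using comp by blast
  obtain L where L: "\<And>n. op_bound (C n \<circ> proj (Y n)) L" using BD(2) unfolding stable_limit_def by blast
  have "compressed Y (\<lambda>n. (A n \<circ> proj (Y n)) \<circ> (C n \<circ> proj (Y n)))"
    by (rule compressed_comp) (use comp op_boundD(2)[OF L] in blast)+
  from compressed_cong[OF this e] stable_limit_cong[OF stable_limit_comp[OF BD] e]
  show ?case by blast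
next
  case (adjoint A)
  let ?a = "\<lambda>n. A n \<circ> proj (Y n)"
  obtain B where B: "stable_limit Y ?a B" using adjoint by blast
  obtain K where K: "\<And>n. op_bound (?a n) K" using B unfolding stable_limit_def by blast
  have adj: "is_adj (?a n) (adj (?a n))" for n using is_adj_adj K bounded_op_iff by blast
  obtain B' where B': "stable_limit Y (\<lambda>n. adj (?a n)) B'"
    by (rule stable_limit_adj[OF B adj])
  have "(proj (Y n) \<circ> adj (?a n) \<circ> proj (Y n) \<circ> proj (Y n)) u = adj (?a n) u" if "u \<in> ell2" for n u
    using compressed_adj[of Y ?a "\<lambda>n. adj (?a n)", OF conjunct1[OF adjoint.IH] adj K that, of n] by simp
  from stable_limit_cong[OF B' this]
  have "\<exists>D. stable_limit Y (\<lambda>n. proj (Y n) \<circ> adj (?a n) \<circ> proj (Y n) \<circ> proj (Y n)) D" by blast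
  moreover have "compressed Y (\<lambda>n. proj (Y n) \<circ> adj (?a n) \<circ> proj (Y n) \<circ> proj (Y n))"
    by (simp add: compressed_def)
  ultimately show ?case by blast
qed

text \<open>For fixed \<open>s\<close> the finitely many points \<open>g + s\<close> lie in
  \<open>Y n\<close> for all large \<open>n\<close>, so deep convergence yields convergence on each
  basis vector; the common bound extends it to all of \<open>ell2\<close>.\<close>

lemma stable_limit_sconv:
  assumes "stable_limit Y c D" and Y_mono: "\<forall>n. Y n \<subseteq> Y (Suc n)" and Y_union: "(\<Union>n. Y n) = UNIV"
  shows "sconv c D"
proof -
  obtain K where c: "\<And>n. op_bound (c n) K" and D: "op_bound D K" and d: "deep_conv Y c D"
    using assms(1) unfolding stable_limit_def by blast
  have "(\<lambda>n. ell2_norm (c n (ket s) - D (ket s))) \<longlonglongrightarrow> 0" for s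
  proof (rule LIMSEQ_I)
    fix \<epsilon> :: real assume "0 < \<epsilon>"
    then have e: "0 < \<epsilon>/2" by simp
    obtain G where G: "finite G" "\<And>k y. (\<lambda>g. g + y) ` G \<subseteq> Y k \<Longrightarrow> ell2_norm (c k (ket y) - D (ket y)) \<le> \<epsilon>/2"
      by (rule deep_convD[OF d e]) blast
    obtain N where N: "\<And>n. n \<ge> N \<Longrightarrow> (\<lambda>g. g + s) ` G \<subseteq> Y n"
      using exhaustion_finite_subset[OF Y_mono Y_union, of "(\<lambda>g. g + s) ` G"] G(1) by blast
    have "ell2_norm (c n (ket s) - D (ket s)) < \<epsilon>" if "n \<ge> N" for n
      using G(2)[OF N[OF that]] \<open>0 < \<epsilon>\<close> by linarith
    then show "\<exists>N. \<forall>n\<ge>N. norm (ell2_norm (c n (ket s) - D (ket s)) - 0) < \<epsilon>" by auto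
  qed
  then have "(\<lambda>n. ell2_norm (c n u - D u)) \<longlonglongrightarrow> 0" if "u \<in> ell2" for u
    using strong_limit_from_ket[OF op_bound_minus[OF c D] _ that] by simp
  then show ?thesis using op_boundD(2)[OF c] op_boundD(2)[OF D] by (auto simp: sconv_def)
qed

text \<open>Every ingredient of the invariant survives approximation in norm that is uniform in
  \<open>n\<close>. The work lies in showing that the limits of the approximants, and all adjoints,
  are as close to those of \<open>A\<close> as the entries are.\<close>

lemma seq_alg_stable:
  assumes A: "seq_alg Y A" and lim: "sconv (\<lambda>n. A n \<circ> proj (Y n)) B"
    and Y_mono: "\<forall>n. Y n \<subseteq> Y (Suc n)" and Y_union: "(\<Union>n. Y n) = UNIV"
  shows "stable_limit Y (\<lambda>n. A n \<circ> proj (Y n)) B" "compressed Y (\<lambda>n. A n \<circ> proj (Y n))"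
proof -
  let ?a = "\<lambda>n. A n \<circ> proj (Y n)"
  have bd: "\<exists>K. op_bound (?a n) K" for n using A bounded_op_iff unfolding seq_alg_def by blast
  have ap: "\<exists>c D L c' D'. (\<forall>n. op_bound (c n) L) \<and> op_bound D L
     \<and> (\<forall>n. is_adj (c n) (c' n)) \<and> is_adj D D'
     \<and> local_op D \<and> local_op D' \<and> deep_conv Y c D \<and> deep_conv Y c' D' \<and> compressed Y c \<and> sconv c D
     \<and> (\<forall>n. \<forall>u\<in>ell2. ell2_norm (?a n u - c n u) \<le> \<epsilon> * ell2_norm u)" if e: "0 < \<epsilon>" for \<epsilon>
  proof -
    obtain C where C: "C \<in> seq_gen Y" and "\<And>n u. u \<in> ell2 \<Longrightarrow>
        ell2_norm (A n (proj (Y n) u) - C n (proj (Y n) u)) \<le> \<epsilon> * ell2_norm u"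
      using A e unfolding seq_alg_def by blast
    moreover obtain D where D: "stable_limit Y (\<lambda>n. C n \<circ> proj (Y n)) D" and "compressed Y (\<lambda>n. C n \<circ> proj (Y n))"
      using seq_gen_stable[OF C] by blast
    moreover note stable_limit_sconv[OF D Y_mono Y_union]
    ultimately show ?thesis unfolding stable_limit_def
      by (intro exI[of _ "\<lambda>n. C n \<circ> proj (Y n)"]) auto
  qed
  \<comment> \<open>\<open>seq_alg\<close> bounds each entry separately. Accuracy 1 against a
    sequence with common bound \<open>L\<close> gives the common bound \<open>1 + L\<close>.\<close>
  obtain K where K: "\<And>n. op_bound (?a n) K"
  proof -
    obtain c L where c: "\<And>n. op_bound (c n) L" and d: "\<And>n u. u \<in> ell2 \<Longrightarrow> ell2_norm (?a n u - c n u) \<le> 1 * ell2_norm u"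
      using ap[of 1] by auto blast
    have "op_bound (?a n) (1 + L)" for n
    proof -
      obtain Kn where Kn: "op_bound (?a n) Kn" using bd by blast
      show ?thesis
      proof (rule op_bound_improve[OF Kn])
        show "0 \<le> 1 + L" using op_boundD(1)[OF c[of 0]] by simp
        fix u :: "'a vec" assume u: "u \<in> ell2"
        show "ell2_norm (?a n u) \<le> (1 + L) * ell2_norm u"
          using ell2_norm_le_add_diff[OF op_boundD(2)[OF Kn u] op_boundD(2)[OF c u, of n]] d[OF u, of n]
            op_boundD(5)[OF c u, of n] by (simp add: algebra_simps)
      qed
    qed
    then show ?thesis by (rule that)
  qed
  have B: "op_bound B K" by (rule sconv_op_bound[OF K lim])
  obtain B' where B': "is_adj B B'" using is_adj_exists[OF B] by blast
  obtain a' where a': "\<And>n. is_adj (?a n) (a' n)" using is_adj_exists[OF K] by metis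
  \<comment> \<open>Closeness that is uniform in \<open>n\<close> passes to the strong
    limits.\<close>
  have BD: "ell2_norm (B u - D u) \<le> \<epsilon> * ell2_norm u"
    if c: "\<And>n. op_bound (c n) L" "sconv c D" and "\<And>n u. u \<in> ell2 \<Longrightarrow> ell2_norm (?a n u - c n u) \<le> \<epsilon> * ell2_norm u"
      and e: "0 < \<epsilon>" and u: "u \<in> ell2" for c D L \<epsilon> u
  proof (rule LIMSEQ_le_const)
    have m: "B u \<in> ell2" "D u \<in> ell2" using lim c u by (auto simp: sconv_def)
    have "(\<lambda>n. ell2_norm (?a n u - B u) + \<epsilon> * ell2_norm u + ell2_norm (c n u - D u)) \<longlonglongrightarrow> 0 + \<epsilon> * ell2_norm u + 0"
      using lim c(2) u unfolding sconv_def by (intro tendsto_add tendsto_const) blast+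
    then show "(\<lambda>n. ell2_norm (?a n u - B u) + \<epsilon> * ell2_norm u + ell2_norm (c n u - D u)) \<longlonglongrightarrow> \<epsilon> * ell2_norm u"
      by simp
    have "ell2_norm (B u - D u) \<le> ell2_norm (?a n u - B u) + \<epsilon> * ell2_norm u + ell2_norm (c n u - D u)" for n
    proof -
      have mn: "?a n u \<in> ell2" "c n u \<in> ell2" using op_boundD(2)[OF K u] op_boundD(2)[OF c(1) u] by auto
      show ?thesis
        using ell2_norm_triangle_sub[OF m(1) mn(1) m(2)] ell2_norm_triangle_sub[OF mn m(2)] that(3)[OF u, of n]
          ell2_norm_minus_commute[of "B u" "?a n u"] by linarith
    qed
    then show "\<exists>N. \<forall>n\<ge>N. ell2_norm (B u - D u) \<le> ell2_norm (?a n u - B u) + \<epsilon> * ell2_norm u + ell2_norm (c n u - D u)"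
      by blast
  qed
  have ap2: "\<exists>c D L c' D'. (\<forall>n. op_bound (c n) L) \<and> op_bound D L \<and> (\<forall>n. op_bound (c' n) L) \<and> op_bound D' L
     \<and> local_op D \<and> local_op D' \<and> deep_conv Y c D \<and> deep_conv Y c' D' \<and> compressed Y c
     \<and> (\<forall>n. \<forall>u\<in>ell2. ell2_norm (?a n u - c n u) \<le> \<epsilon> * ell2_norm u)
     \<and> (\<forall>n. \<forall>u\<in>ell2. ell2_norm (a' n u - c' n u) \<le> \<epsilon> * ell2_norm u)
     \<and> (\<forall>u\<in>ell2. ell2_norm (B u - D u) \<le> \<epsilon> * ell2_norm u)
     \<and> (\<forall>u\<in>ell2. ell2_norm (B' u - D' u) \<le> \<epsilon> * ell2_norm u)" if e: "0 < \<epsilon>" for \<epsilon>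
  proof -
    obtain c D L c' D' where c: "\<And>n. op_bound (c n) L" "op_bound D L"
     "\<And>n. is_adj (c n) (c' n)" "is_adj D D'"
     "local_op D" "local_op D'" "deep_conv Y c D" "deep_conv Y c' D'" "compressed Y c" "sconv c D"
     "\<And>n u. u\<in>ell2 \<Longrightarrow> ell2_norm (?a n u - c n u) \<le> \<epsilon> * ell2_norm u"
      using ap[OF e] by blast
    have 1: "ell2_norm (B u - D u) \<le> \<epsilon> * ell2_norm u" if "u \<in> ell2" for u
      by (rule BD[OF c(1,10,11) e that])
    have 2: "ell2_norm (B' u - D' u) \<le> \<epsilon> * ell2_norm u" if "u \<in> ell2" for u
      by (rule is_adj_diff_norm[OF B' c(4) B c(2) less_imp_le[OF e] 1 that])
    have 3: "ell2_norm (a' n u - c' n u) \<le> \<epsilon> * ell2_norm u" if "u \<in> ell2" for n u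
      by (rule is_adj_diff_norm[OF a' c(3) K c(1) less_imp_le[OF e] c(11) that])
    have 4: "op_bound (c' n) L" "op_bound D' L" for n
      using is_adj_op_bound[OF c(1,3)] is_adj_op_bound[OF c(2,4)] by auto
    show ?thesis
      by (intro exI[of _ c] exI[of _ D] exI[of _ L] exI[of _ c'] exI[of _ D'] conjI allI ballI)
        (fact c 1 2 3 4 | rule c 1 2 3 4; assumption)+
  qed
  have "local_op B"
    by (rule local_op_limit[OF B]) (use ap2 in blast)
  moreover have "local_op B'"
    by (rule local_op_limit[OF is_adj_op_bound[OF B B']]) (use ap2 in blast)
  moreover have "deep_conv Y ?a B"
    by (rule deep_conv_limit[OF K B]) (use ap2 in blast)
  moreover have "deep_conv Y a' B'"
    by (rule deep_conv_limit[OF is_adj_op_bound[OF K a'] is_adj_op_bound[OF B B']]) (use ap2 in blast)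
  ultimately show "stable_limit Y ?a B" unfolding stable_limit_def
    using K B a' B' by blast
  have "proj (Y n) (?a n u) = ?a n u" if u: "u \<in> ell2" for n u
  proof -
    have m: "?a n u \<in> ell2" by (rule op_boundD(2)[OF K u])
    \<comment> \<open>The approximants vanish off \<open>Y n\<close>, so there the coordinates of
      \<open>?a n u\<close> fall below every positive bound.\<close>
    have small: "cmod (?a n u t) \<le> \<epsilon> * ell2_norm u" if t: "t \<notin> Y n" and eps: "0 < \<epsilon>" for t \<epsilon>
    proof -
      obtain c L where c: "\<And>n. op_bound (c n) L" "compressed Y c"
        "ell2_norm (?a n u - c n u) \<le> \<epsilon> * ell2_norm u" using ap[OF eps] u by blast
      have "proj (Y n) (c n u) = c n u" using c(2) u by (simp add: compressed_def)
      from fun_cong[OF this, of t] have "c n u t = 0" using t by (simp add: proj_def)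
      then show ?thesis
        using cmod_le_ell2_norm[OF ell2_diff(1)[OF m op_boundD(2)[OF c(1) u, of n]], of t] c(3) by simp
    qed
    have "?a n u t = 0" if "t \<notin> Y n" for t
    proof -
      have "cmod (?a n u t) \<le> e" if e: "0 < e" for e
      proof -
        have p: "0 < ell2_norm u + 1" by (simp add: add_nonneg_pos)
        have "cmod (?a n u t) \<le> e / (ell2_norm u + 1) * ell2_norm u"
          by (rule small[OF \<open>t \<notin> Y n\<close>]) (use e p in simp)
        also have "\<dots> \<le> e / (ell2_norm u + 1) * (ell2_norm u + 1)"
          using e p by (intro mult_left_mono) auto
        finally show ?thesis using p by simp
      qed
      then have "cmod (?a n u t) \<le> 0" by (meson dense_ge)
      then show ?thesis by simp
    qed
    then show ?thesis by (auto simp: proj_def fun_eq_iff)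
  qed
  then show "compressed Y ?a" by (auto simp: compressed_def)
qed

subsection \<open>Block diagonal operators\<close>

lemma Rsh_Rsh: "Rsh r (Rsh s u) = Rsh (r + s) u"
  by (simp add: Rsh_def add.assoc)

lemma Rsh_ket: "Rsh r (ket s) = ket (s - r)"
  by (auto simp: Rsh_def ket_def fun_eq_iff eq_diff_eq)

lemma sum_fun_apply: "(\<Sum>n\<in>I. f n) t = (\<Sum>n\<in>I. f n t)" for f :: "'i \<Rightarrow> 'g vec"
  by (induction I rule: infinite_finite_induct) auto

text \<open>The condition \<open>t + v n \<in> Y n\<close> says that \<open>t\<close> lies in the
  right translate of \<open>Y n\<close> by \<open>- v n\<close>; \<open>disj\<close> makes these
  supports of the blocks disjoint.\<close>

locale block_family =
  fixes Y :: "nat \<Rightarrow> 'g::group_add set" and v :: "nat \<Rightarrow> 'g" and a :: "nat \<Rightarrow> 'g op" and K :: real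
  assumes Y_fin: "finite (Y n)"
    and disj: "t + v m \<in> Y m \<Longrightarrow> t + v n \<in> Y n \<Longrightarrow> m = n"
    and a_bound: "op_bound (a n) K"
    and a_compressed: "compressed Y a"
begin

definition blk :: "nat \<Rightarrow> 'g set" where
  "blk n = {t. t + v n \<in> Y n}"

definition block :: "nat \<Rightarrow> 'g op" where
  "block n = Rsh (v n) \<circ> a n \<circ> Rsh (- v n)"

text \<open>The block sum, given coordinate by coordinate: at most one \<open>blk n\<close> contains
  \<open>t\<close>, so \<open>SOME\<close> is unambiguous. That the series converges strongly to it
  is proved afterwards.\<close>

definition diag :: "'g op" where
  "diag u t = (if \<exists>n. t \<in> blk n then block (SOME n. t \<in> blk n) u t else 0)"

lemma blk_unique: "t \<in> blk m \<Longrightarrow> t \<in> blk n \<Longrightarrow> m = n"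
  using disj by (simp add: blk_def)

lemma finite_blk: "finite (blk n)"
proof -
  have "blk n = (\<lambda>y. y - v n) ` Y n" by (force simp: blk_def image_iff)
  then show ?thesis using Y_fin by simp
qed

lemma finite_blk_meets:
  assumes "finite F" shows "finite {n. F \<inter> blk n \<noteq> {}}"
proof (rule finite_surj[OF assms])
  show "{n. F \<inter> blk n \<noteq> {}} \<subseteq> (\<lambda>t. SOME n. t \<in> blk n) ` F"
  proof
    fix n assume "n \<in> {n. F \<inter> blk n \<noteq> {}}"
    then obtain t where t: "t \<in> F" "t \<in> blk n" by auto
    then have "(SOME n. t \<in> blk n) = n" using blk_unique by (metis someI_ex)
    then show "n \<in> (\<lambda>t. SOME n. t \<in> blk n) ` F" using t by (metis image_eqI)
  qed
qed

lemma diag_blk: "t \<in> blk n \<Longrightarrow> diag u t = block n u t"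
  unfolding diag_def using blk_unique by (metis (mono_tags, lifting) someI_ex)

lemma diag_not_blk: "(\<And>n. t \<notin> blk n) \<Longrightarrow> diag u t = 0"
  by (simp add: diag_def)

lemma block_bound: "op_bound (block n) K"
  using op_bound_comp[OF op_bound_comp[OF op_bound_translate(1) a_bound] op_bound_translate(1), of "v n" n "- v n"]
  by (simp add: block_def)

lemma block_support:
  assumes "u \<in> ell2" "t \<notin> blk n" shows "block n u t = 0"
proof -
  have "proj (Y n) (a n (Rsh (- v n) u)) = a n (Rsh (- v n) u)"
    using a_compressed ell2_translate(1)[OF assms(1)] by (simp add: compressed_def)
  from fun_cong[OF this, of "t + v n"] show ?thesis
    using assms(2) by (simp add: proj_def blk_def block_def Rsh_def)
qed

lemma block_proj:
  assumes "u \<in> ell2" shows "block n (proj (blk n) u) = block n u"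
proof -
  have "Rsh (- v n) (proj (blk n) u) = proj (Y n) (Rsh (- v n) u)"
    by (auto simp: Rsh_def proj_def blk_def fun_eq_iff)
  then have "a n (Rsh (- v n) (proj (blk n) u)) = a n (Rsh (- v n) u)"
    using a_compressed ell2_translate(1)[OF assms] by (simp add: compressed_def)
  then show ?thesis by (simp add: block_def)
qed

text \<open>Pythagoras over the blocks: each block sees only the part of \<open>u\<close> on its own
  coordinates, and these parts are orthogonal, so the common bound \<open>K\<close> survives the
  summation.\<close>

lemma diag_L2_bound:
  assumes u: "u \<in> ell2" and F: "finite F"
  shows "L2_set (\<lambda>t. cmod (diag u t)) F \<le> K * ell2_norm u"
proof -
  \<comment> \<open>Only finitely many blocks meet \<open>F\<close>, so all sums stay
    finite.\<close>
  define I where "I = {n. F \<inter> blk n \<noteq> {}}"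
  have K: "0 \<le> K" by (rule op_boundD(1)[OF a_bound])
  have I: "finite I" unfolding I_def by (rule finite_blk_meets[OF F])
  have "(\<Sum>t\<in>F. (cmod (diag u t))\<^sup>2) = (\<Sum>t\<in>(\<Union>n\<in>I. F \<inter> blk n). (cmod (diag u t))\<^sup>2)"
  proof (rule sum.mono_neutral_right)
    show "\<forall>t\<in>F - (\<Union>n\<in>I. F \<inter> blk n). (cmod (diag u t))\<^sup>2 = 0"
    proof
      fix t assume "t \<in> F - (\<Union>n\<in>I. F \<inter> blk n)"
      then have "t \<notin> blk n" for n by (auto simp: I_def)
      then show "(cmod (diag u t))\<^sup>2 = 0" by (simp add: diag_not_blk)
    qed
  qed (use F in auto)
  also have "\<dots> = (\<Sum>n\<in>I. \<Sum>t\<in>F \<inter> blk n. (cmod (diag u t))\<^sup>2)"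
    by (rule sum.UNION_disjoint) (use I F in \<open>auto dest: blk_unique\<close>)
  also have "\<dots> \<le> (\<Sum>n\<in>I. K\<^sup>2 * (\<Sum>t\<in>blk n. (cmod (u t))\<^sup>2))"
  proof (rule sum_mono)
    fix n
    have "(\<Sum>t\<in>F \<inter> blk n. (cmod (diag u t))\<^sup>2) = (L2_set (\<lambda>t. cmod (block n u t)) (F \<inter> blk n))\<^sup>2"
      by (auto simp: L2_set_def sum_nonneg diag_blk intro!: sum.cong)
    also have "\<dots> \<le> (ell2_norm (block n u))\<^sup>2"
      by (intro power_mono L2_set_le_ell2_norm op_boundD(2)[OF block_bound u]) auto
    also have "\<dots> \<le> (K * ell2_norm (proj (blk n) u))\<^sup>2"
      using op_boundD(5)[OF block_bound proj_ell2(1)[OF u], of n "blk n"] block_proj[OF u]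
      by (intro power_mono) auto
    also have "\<dots> = K\<^sup>2 * (\<Sum>t\<in>blk n. (cmod (u t))\<^sup>2)"
      unfolding ell2_norm_proj_finite[OF finite_blk] by (simp add: power_mult_distrib L2_set_def sum_nonneg)
    finally show "(\<Sum>t\<in>F \<inter> blk n. (cmod (diag u t))\<^sup>2) \<le> K\<^sup>2 * (\<Sum>t\<in>blk n. (cmod (u t))\<^sup>2)" .
  qed
  also have "\<dots> = K\<^sup>2 * (\<Sum>t\<in>(\<Union>n\<in>I. blk n). (cmod (u t))\<^sup>2)"
    unfolding sum_distrib_left[symmetric]
    by (subst sum.UNION_disjoint) (use I finite_blk in \<open>auto dest: blk_unique\<close>)
  also have "\<dots> = K\<^sup>2 * (L2_set (\<lambda>t. cmod (u t)) (\<Union>n\<in>I. blk n))\<^sup>2"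
    by (simp add: L2_set_def sum_nonneg)
  also have "\<dots> \<le> K\<^sup>2 * (ell2_norm u)\<^sup>2"
    by (intro mult_left_mono power_mono L2_set_le_ell2_norm u) auto
  finally have "(\<Sum>t\<in>F. (cmod (diag u t))\<^sup>2) \<le> (K * ell2_norm u)\<^sup>2" by (simp add: power_mult_distrib)
  then show ?thesis unfolding L2_set_def using K by (intro real_le_lsqrt) (auto intro: sum_nonneg)
qed

lemma diag_bound: "op_bound diag K"
proof -
  have K: "0 \<le> K" by (rule op_boundD(1)[OF a_bound])
  have "diag u \<in> ell2" "ell2_norm (diag u) \<le> K * ell2_norm u" if "u \<in> ell2" for u
    using ell2_bound[of "K * ell2_norm u" "diag u"] diag_L2_bound[OF that] K by auto
  moreover have "diag (u + w) = diag u + diag w" if "u \<in> ell2" "w \<in> ell2" for u w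
  proof
    fix t show "diag (u + w) t = (diag u + diag w) t"
      using op_boundD(3)[OF block_bound that] by (cases "\<exists>n. t \<in> blk n") (auto simp: diag_blk diag_not_blk)
  qed
  moreover have "diag (\<lambda>t. c * u t) = (\<lambda>t. c * diag u t)" if "u \<in> ell2" for u c
  proof
    fix t show "diag (\<lambda>t. c * u t) t = c * diag u t"
      using op_boundD(4)[OF block_bound that] by (cases "\<exists>n. t \<in> blk n") (auto simp: diag_blk diag_not_blk)
  qed
  ultimately show ?thesis using K by (auto simp: op_bound_def)
qed

text \<open>The remainder after \<open>N\<close> blocks is \<open>diag u\<close> restricted to the
  later blocks, and these avoid any given finite set once \<open>N\<close> is large.\<close>

lemma diag_sconv: "sconv (\<lambda>N u. \<Sum>n<N. block n u) diag"
  unfolding sconv_def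
proof (intro ballI conjI allI)
  fix u :: "'g vec" assume u: "u \<in> ell2"
  show d: "diag u \<in> ell2" by (rule op_boundD(2)[OF diag_bound u])
  have e: "diag u - (\<Sum>n<N. block n u) = proj (\<Union>n\<in>{N..}. blk n) (diag u)" for N
  proof
    fix t
    show "(diag u - (\<Sum>n<N. block n u)) t = proj (\<Union>n\<in>{N..}. blk n) (diag u) t"
    proof (cases "\<exists>n. t \<in> blk n")
      case True
      then obtain n where n: "t \<in> blk n" by blast
      have "block m u t = (if m = n then block n u t else 0)" for m
        using block_support[OF u, of t m] blk_unique[OF n, of m] by auto
      then have "(\<Sum>m<N. block m u t) = (\<Sum>m<N. if m = n then block n u t else 0)"
        by (rule sum.cong[OF refl])
      also have "\<dots> = (if n < N then block n u t else 0)" by simp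
      finally have "(diag u - (\<Sum>n<N. block n u)) t = (if n < N then 0 else diag u t)"
        using diag_blk[OF n] by (simp add: sum_fun_apply)
      moreover have "t \<in> (\<Union>n\<in>{N..}. blk n) \<longleftrightarrow> N \<le> n"
        using n by (auto dest: blk_unique[OF n])
      ultimately show ?thesis by (simp add: proj_def)
    next
      case False
      then have "block m u t = 0" for m using block_support[OF u] by blast
      then show ?thesis using False by (simp add: proj_def sum_fun_apply diag_not_blk)
    qed
  qed
  show "(\<Sum>n<N. block n u) \<in> ell2" for N
  proof (induction N)
    case 0
    show ?case unfolding lessThan_0 sum.empty by (rule ell2_zero)
  next
    case (Suc N)
    then show ?case unfolding sum.lessThan_Suc by (rule ell2_add(1)) (rule op_boundD(2)[OF block_bound u])
  qed
  show "(\<lambda>N. ell2_norm ((\<Sum>n<N. block n u) - diag u)) \<longlonglongrightarrow> 0"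
  proof (rule LIMSEQ_I)
    fix \<epsilon> :: real assume "0 < \<epsilon>"
    then obtain F where F: "finite F" "\<And>X. X \<inter> F = {} \<Longrightarrow> ell2_norm (proj X (diag u)) \<le> \<epsilon>/2"
      using ell2_tail[OF d, of "\<epsilon>/2"] by auto
    define I where "I = {n. F \<inter> blk n \<noteq> {}}"
    have "finite I" unfolding I_def by (rule finite_blk_meets[OF F(1)])
    then obtain N where N: "\<And>n. n \<in> I \<Longrightarrow> n < N" unfolding finite_nat_set_iff_bounded by blast
    have "ell2_norm ((\<Sum>n<M. block n u) - diag u) < \<epsilon>" if "N \<le> M" for M
    proof -
      have "(\<Union>n\<in>{M..}. blk n) \<inter> F = {}"
      proof (rule ccontr)
        assume "(\<Union>n\<in>{M..}. blk n) \<inter> F \<noteq> {}"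
        then obtain n where "M \<le> n" "n \<in> I" by (auto simp: I_def)
        then show False using N[of n] that by simp
      qed
      from F(2)[OF this] show ?thesis
        using e[of M] ell2_norm_minus_commute[of "\<Sum>n<M. block n u" "diag u"] \<open>0 < \<epsilon>\<close> by simp
    qed
    then show "\<exists>N. \<forall>M\<ge>N. norm (ell2_norm ((\<Sum>n<M. block n u) - diag u) - 0) < \<epsilon>" by auto
  qed
qed

lemma Gamma'_eq: "t \<in> Gamma' Y v \<longleftrightarrow> (\<forall>n. t \<notin> blk n)"
proof -
  have "setmul (Y n) {- v n} = blk n" for n
    by (force simp: setmul_def blk_def add.assoc)
  then show ?thesis by (simp add: Gamma'_def)
qed

definition ext_diag :: "'g op" where
  "ext_diag u = diag u + proj (Gamma' Y v) u"

lemma ext_diag_bound: "op_bound ext_diag (K + 1)"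
  using op_bound_plus[OF diag_bound op_bound_proj] by (simp add: ext_diag_def[abs_def])

lemma ext_diag_blk: "t \<in> blk n \<Longrightarrow> ext_diag u t = block n u t"
  using Gamma'_eq by (auto simp: ext_diag_def diag_blk proj_def)

text \<open>A basis vector supported in the \<open>k\<close>-th block is seen neither by the other
  blocks nor by the projection onto \<open>Gamma' Y v\<close>.\<close>

lemma ext_diag_ket:
  assumes "s \<in> Y k"
  shows "ext_diag (ket (s - v k)) = Rsh (v k) (a k (ket s))"
proof -
  have b: "block k (ket (s - v k)) = Rsh (v k) (a k (ket s))"
    by (simp add: block_def Rsh_ket)
  have sk: "s - v k \<in> blk k" using assms by (simp add: blk_def)
  have "ext_diag (ket (s - v k)) t = block k (ket (s - v k)) t" for t
  proof (cases "\<exists>n. t \<in> blk n")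
    case True
    then obtain n where n: "t \<in> blk n" by blast
    show ?thesis
    proof (cases "n = k")
      case False
      then have "proj (blk n) (ket (s - v k)) = 0"
        using blk_unique[OF sk, of n] by (auto simp: proj_def ket_def fun_eq_iff)
      then have "block n (ket (s - v k)) = 0"
        using block_proj[OF ket_ell2(1), of n "s - v k"] op_bound_zero[OF block_bound[of n]] by metis
      moreover have "t \<notin> blk k" using n False blk_unique by blast
      ultimately show ?thesis using ext_diag_blk[OF n] block_support[OF ket_ell2(1)] by simp
    qed (use n ext_diag_blk in simp)
  next
    case False
    then have "t \<noteq> s - v k" using sk by blast
    then show ?thesis
      using False block_support[OF ket_ell2(1)] by (simp add: ext_diag_def diag_not_blk proj_def ket_def)
  qed
  then show ?thesis using b by auto
qed

text \<open>Computed by entries: the row of \<open>ext_diag\<close> at a point of the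
  \<open>k\<close>-th block is the row of that block alone.\<close>

lemma ext_diag_adj_ket:
  assumes T': "is_adj ext_diag T'" and a': "is_adj (a k) a'" and s: "s \<in> Y k"
  shows "T' (ket (s - v k)) = Rsh (v k) (a' (ket s))"
proof
  fix t
  have "T' (ket (s - v k)) t = ell2_inner (ext_diag (ket t)) (ket (s - v k))"
    using T' unfolding is_adj_def by (metis inner_ket_left ket_ell2(1))
  also have "\<dots> = cnj (ext_diag (ket t) (s - v k))" by (rule inner_ket_right)
  also have "ext_diag (ket t) (s - v k) = block k (ket t) (s - v k)"
    by (rule ext_diag_blk) (use s in \<open>simp add: blk_def\<close>)
  also have "\<dots> = a k (ket (t + v k)) s" by (simp add: block_def Rsh_ket) (simp add: Rsh_def)
  also have "cnj \<dots> = ell2_inner (a k (ket (t + v k))) (ket s)" by (simp add: inner_ket_right)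
  also have "\<dots> = ell2_inner (ket (t + v k)) (a' (ket s))"
    using a' unfolding is_adj_def by (metis ket_ell2(1))
  also have "\<dots> = Rsh (v k) (a' (ket s)) t" by (simp add: inner_ket_left Rsh_def)
  finally show "T' (ket (s - v k)) t = Rsh (v k) (a' (ket s)) t" .
qed

end

text \<open>On \<open>ket s\<close> the inner translation gives
  \<open>ket ((s + y m) - v (k m))\<close>, whose image under \<open>T\<close> is read off from
  block \<open>k m\<close>, and the outer translations combine to \<open>Rsh (y m)\<close>. What
  remains is a translate of the column of \<open>a - B\<close> at \<open>s + y m\<close>.
  \<open>T\<close> is kept abstract to cover the operator and its adjoint alike.\<close>

lemma deep_transfer:
  fixes Y :: "nat \<Rightarrow> 'g::group_add set"
  assumes T: "op_bound T M" and B: "op_bound B L" and deep: "deep_conv Y a B"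
    and a: "\<And>k s. s \<in> Y k \<Longrightarrow> T (ket (s - v k)) = Rsh (v k) (a k (ket s))"
    and am: "\<And>k s. a k (ket s) \<in> ell2"
    and exh: "\<And>F. finite F \<Longrightarrow> \<forall>\<^sub>F m in sequentially. (\<lambda>g. g + y m) ` F \<subseteq> Y (k m)"
    and h: "\<And>m. h m = v (k m) - y m" and u: "u \<in> ell2"
  shows "(\<lambda>m. ell2_norm (Rsh (- h m) (T (Rsh (h m) u)) - Rsh (y m) (B (Rsh (- y m) u)))) \<longlonglongrightarrow> 0"
proof -
  define D where "D = (\<lambda>m u. (Rsh (- h m) \<circ> T \<circ> Rsh (h m)) u - (Rsh (y m) \<circ> B \<circ> Rsh (- y m)) u)"
  have D: "op_bound (D m) (M + L)" for m
    using op_bound_minus[OF op_bound_comp[OF op_bound_comp[OF op_bound_translate(1) T] op_bound_translate(1)]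
        op_bound_comp[OF op_bound_comp[OF op_bound_translate(1) B] op_bound_translate(1)],
        of "- h m" "h m" "y m" "- y m"]
    by (simp add: D_def)
  have "(\<lambda>m. ell2_norm (D m (ket s))) \<longlonglongrightarrow> 0" for s
  proof (rule tendstoI)
    fix \<epsilon> :: real assume "0 < \<epsilon>"
    then have e: "0 < \<epsilon>/2" by simp
    obtain G where G: "finite G" "\<And>k y. (\<lambda>g. g + y) ` G \<subseteq> Y k \<Longrightarrow> ell2_norm (a k (ket y) - B (ket y)) \<le> \<epsilon>/2"
      by (rule deep_convD[OF deep e]) blast
    \<comment> \<open>The point \<open>s\<close> itself brings \<open>s + y m\<close> into the
      block; its neighbours \<open>g + s\<close> make it deep.\<close>
    have "\<forall>\<^sub>F m in sequentially. (\<lambda>g. g + y m) ` (insert s ((\<lambda>g. g + s) ` G)) \<subseteq> Y (k m)"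
      by (rule exh) (use G in simp)
    then show "\<forall>\<^sub>F m in sequentially. dist (ell2_norm (D m (ket s))) 0 < \<epsilon>"
    proof eventually_elim
      case (elim m)
      have s: "s + y m \<in> Y (k m)" using elim by auto
      have hm: "- h m + v (k m) = y m" "s - h m = (s + y m) - v (k m)"
        by (simp_all add: h diff_diff_eq2)
      have "D m (ket s) = Rsh (y m) (a (k m) (ket (s + y m)) - B (ket (s + y m)))"
        using a[OF s] hm by (simp add: D_def Rsh_ket Rsh_Rsh) (simp add: Rsh_def fun_eq_iff)
      moreover have "(\<lambda>g. g + (s + y m)) ` G \<subseteq> Y (k m)"
        using elim by (force simp: add.assoc[symmetric])
      ultimately have "ell2_norm (D m (ket s)) \<le> \<epsilon>/2" using G(2) by simp
      then show ?case using \<open>0 < \<epsilon>\<close> by simp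
    qed
  qed
  from strong_limit_from_ket[OF D this u] show ?thesis by (simp add: D_def fun_diff_def)
qed

subsection \<open>Limit operators\<close>

lemma Zset_superset:
  assumes "w \<in> Y n \<union> Omega_pow Om n" shows "w \<in> Zset Om Y n"
proof -
  have "0 \<in> Omega_pow Om n" by (auto simp: Omega_pow_def intro!: exI[of _ "[]"])
  moreover have "w = w + - 0 + 0" by simp
  ultimately show ?thesis using assms unfolding Zset_def Let_def setmul_def setinv_def by blast
qed

lemma inflating_disjoint:
  assumes "inflating Z v" "t + v m \<in> Z m" "t + v n \<in> Z n"
  shows "m = n"
proof (rule ccontr)
  assume "m \<noteq> n"
  moreover have "t \<in> setmul (Z k) {- v k}" if "t + v k \<in> Z k" for k
    using that unfolding setmul_def by (auto intro!: exI[of _ "t + v k"] simp: add.assoc)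
  ultimately show False using assms unfolding inflating_def by blast
qed

text \<open>Every \<open>Zset Om Y k\<close> contains 0, so equal values of \<open>v\<close> would
  make two of the translates meet. Injectivity lets \<open>v k\<close> escape from finite sets in
  the converse direction.\<close>

lemma inflating_inj:
  assumes "inflating (Zset Om Y) v" shows "inj v"
proof (rule injI)
  fix m n assume "v m = v n"
  moreover have "0 \<in> Zset Om Y k" for k
    by (rule Zset_superset) (auto simp: Omega_pow_def intro!: exI[of _ "[]"])
  ultimately show "m = n" using inflating_disjoint[OF assms, of "- v m" m n] by simp
qed

lemma Omega_pow_mono: "r \<le> s \<Longrightarrow> Omega_pow Om r \<subseteq> Omega_pow Om s"
  by (force simp: Omega_pow_def)

lemma Omega_pow_finite_subset:
  assumes gen: "\<forall>g. \<exists>xs. set xs \<subseteq> Om \<and> sum_list xs = g" and "finite F"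
  shows "\<exists>r. F \<subseteq> Omega_pow Om r"
  using assms(2)
proof (induction F rule: finite_induct)
  case (insert x F)
  obtain r where r: "F \<subseteq> Omega_pow Om r" using insert by blast
  obtain xs where xs: "set xs \<subseteq> Om" "sum_list xs = x" using gen by blast
  have "x \<in> Omega_pow Om (length xs)" using xs by (auto simp: Omega_pow_def)
  then have "insert x F \<subseteq> Omega_pow Om (max r (length xs))"
    using r Omega_pow_mono[of r "max r (length xs)" Om] Omega_pow_mono[of "length xs" "max r (length xs)" Om] by auto
  then show ?case by blast
qed simp

text \<open>A walk from \<open>y\<close> by left multiplication with generators can leave
  \<open>X\<close> only from a boundary point, and none is met within \<open>R\<close> steps. In the
  induction the head of the list is the last step of the walk.\<close>

lemma Omega_pow_translate_subset:
  assumes "y \<in> X" and far: "\<And>r w. r \<le> R \<Longrightarrow> w \<in> Omega_pow Om r \<Longrightarrow> w + y \<notin> bd_Om Om X"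
  shows "(\<lambda>w. w + y) ` Omega_pow Om R \<subseteq> X"
proof -
  have "sum_list xs + y \<in> X" if "set xs \<subseteq> Om" "length xs \<le> R" for xs
    using that
  proof (induction xs)
    case Nil
    then show ?case using assms(1) by simp
  next
    case (Cons x xs)
    have "sum_list xs \<in> Omega_pow Om (length xs)" using Cons.prems by (auto simp: Omega_pow_def)
    then have "sum_list xs + y \<notin> bd_Om Om X" using far[of "length xs"] Cons.prems by simp
    then have "sum_list xs + y \<in> int_Om Om X" using Cons by (simp add: bd_Om_def)
    then show ?case using Cons.prems by (simp add: int_Om_def add.assoc)
  qed
  then show ?thesis by (auto simp: Omega_pow_def)
qed

lemma sconv_transfer:
  assumes "sconv Q C" and P: "\<And>m u. u \<in> ell2 \<Longrightarrow> P m u \<in> ell2"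
    and d: "\<And>u. u \<in> ell2 \<Longrightarrow> (\<lambda>m. ell2_norm (P m u - Q m u)) \<longlonglongrightarrow> 0"
  shows "sconv P C"
  unfolding sconv_def
proof (intro ballI conjI allI)
  fix u :: "'a vec" assume u: "u \<in> ell2"
  show C: "C u \<in> ell2" and "P m u \<in> ell2" for m using assms u by (auto simp: sconv_def)
  have Q: "Q m u \<in> ell2" for m using assms(1) u by (auto simp: sconv_def)
  have "(\<lambda>m. ell2_norm (P m u - Q m u) + ell2_norm (Q m u - C u)) \<longlonglongrightarrow> 0 + 0"
    using assms(1) u by (intro tendsto_add d) (auto simp: sconv_def)
  then have lim: "(\<lambda>m. ell2_norm (P m u - Q m u) + ell2_norm (Q m u - C u)) \<longlonglongrightarrow> 0" by simp
  have "norm (ell2_norm (P m u - C u)) \<le> ell2_norm (P m u - Q m u) + ell2_norm (Q m u - C u)" for m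
    using ell2_norm_triangle_sub[OF P[OF u] Q C] by simp
  then show "(\<lambda>m. ell2_norm (P m u - C u)) \<longlonglongrightarrow> 0"
    by (intro Lim_null_comparison[OF always_eventually lim]) blast
qed

lemma op_bound_conj_Rsh: "op_bound B K \<Longrightarrow> op_bound (Rsh r \<circ> B \<circ> Rsh s) K"
  using op_bound_comp[OF op_bound_comp[OF op_bound_translate(1)] op_bound_translate(1), of B K r s] by simp

theorem mainTheorem9:
  fixes Om :: "('g::{group_add,countable}) set"
    and Y :: "nat \<Rightarrow> 'g set"
    and v :: "nat \<Rightarrow> 'g"
    and A :: "nat \<Rightarrow> 'g op"
    and Alim :: "'g op"
    and h :: "nat \<Rightarrow> 'g"
    and H :: "'g op"
  assumes Om_fin: "finite Om" and Om_e: "0 \<in> Om"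
    and Om_gen: "\<forall>g. \<exists>xs. set xs \<subseteq> Om \<and> sum_list xs = g"
    and Y_mono: "\<forall>n. Y n \<subseteq> Y (Suc n)" and Y_fin: "\<forall>n. finite (Y n)"
    and Y_union: "(\<Union>n. Y n) = UNIV"
    and v_infl: "inflating (Zset Om Y) v"
    and A_in: "seq_alg Y A"
    and A_lim: "sconv (\<lambda>n. A n \<circ> proj (Y n)) Alim"
  shows
    "((tends_to_infinity h \<and>
        is_limit_op (\<lambda>u. Op Y v A u + proj (Gamma' Y v) u) h H \<and>
        (\<exists>k. (\<forall>n. h n \<in> setmul {v (k n)} (setinv (Y (k n)))) \<and>
             filterlim (\<lambda>n. LEAST r. h n \<in>
                  setmul (setmul {v (k n)} (setinv (bd_Om Om (Y (k n))))) (Omega_pow Om r))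
               at_top sequentially))
      \<longrightarrow> (\<exists>vs. op_eq H (Rsh (- vs) \<circ> Alim \<circ> Rsh vs)) \<or>
          (\<exists>g. tends_to_infinity g \<and> is_limit_op Alim g H))
     \<and> (\<forall>vs. \<exists>h'. tends_to_infinity h' \<and>
          is_limit_op (\<lambda>u. Op Y v A u + proj (Gamma' Y v) u) h' (Rsh (- vs) \<circ> Alim \<circ> Rsh vs))
     \<and> (\<forall>g C. tends_to_infinity g \<and> is_limit_op Alim g C \<longrightarrow>
          (\<exists>h'. tends_to_infinity h' \<and>
             is_limit_op (\<lambda>u. Op Y v A u + proj (Gamma' Y v) u) h' C))"
proof -
  let ?a = "\<lambda>n. A n \<circ> proj (Y n)"
  define T where "T = (\<lambda>u. Op Y v A u + proj (Gamma' Y v) u)"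
  obtain K a' B' where a: "\<And>n. op_bound (?a n) K" and Alim: "op_bound Alim K"
    and a': "\<And>n. is_adj (?a n) (a' n)" and B': "is_adj Alim B'"
    and deep: "deep_conv Y ?a Alim" and deepB': "deep_conv Y a' B'"
    using seq_alg_stable(1)[OF A_in A_lim Y_mono Y_union] unfolding stable_limit_def by blast
  interpret block_family Y v ?a K
  proof
    show "m = n" if "t + v m \<in> Y m" "t + v n \<in> Y n" for t m n
      by (rule inflating_disjoint[OF v_infl]) (use that in \<open>auto intro: Zset_superset\<close>)
  qed (use Y_fin a seq_alg_stable(2)[OF A_in A_lim Y_mono Y_union] in auto)
  have sD: "sconv (\<lambda>N u. \<Sum>n<N. Rsh (v n) (A n (proj (Y n) (Rsh (- v n) u)))) diag"
    using diag_sconv by (simp add: block_def)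
  \<comment> \<open>\<open>Op\<close> is chosen by \<open>SOME\<close>; since strong limits are
    unique on \<open>ell2\<close>, the choice agrees there with \<open>diag\<close>.\<close>
  from someI[of "sconv (\<lambda>N u. \<Sum>n<N. Rsh (v n) (A n (proj (Y n) (Rsh (- v n) u))))", OF this]
  have "sconv (\<lambda>N u. \<Sum>n<N. Rsh (v n) (A n (proj (Y n) (Rsh (- v n) u)))) (Op Y v A)"
    unfolding Op_def .
  then have OpD: "Op Y v A u = diag u" if "u \<in> ell2" for u
    by (rule sconv_unique[OF _ sD that])
  then have T_eq: "T u = ext_diag u" if "u \<in> ell2" for u using that by (simp add: ext_diag_def T_def)
  have Tb: "op_bound T (K + 1)" by (rule op_bound_cong[OF ext_diag_bound T_eq])
  have Tadj: "is_adj T (adj T)" by (rule is_adj_adj) (use Tb bounded_op_iff in blast)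
  have Tadj': "is_adj ext_diag (adj T)" by (rule is_adj_cong[OF Tadj]) (simp_all add: T_eq)
  have Tadjb: "op_bound (adj T) (K + 1)" by (rule is_adj_op_bound[OF Tb Tadj])
  have Aadj: "is_adj Alim (adj Alim)" by (rule is_adj_adj) (use Alim bounded_op_iff in blast)
  have Aadjb: "op_bound (adj Alim) K" by (rule is_adj_op_bound[OF Alim Aadj])
  \<comment> \<open>The adjoint from the invariant and \<open>adj Alim\<close> agree on
    \<open>ell2\<close>; limit operators are stated with the latter.\<close>
  have deep': "deep_conv Y a' (adj Alim)"
    using deepB' is_adj_unique[OF B' Aadj] unfolding deep_conv_def by simp
  have a'b: "op_bound (a' n) K" for n by (rule is_adj_op_bound[OF a a'])
  have Tket: "T (ket (s - v k)) = Rsh (v k) (?a k (ket s))" if "s \<in> Y k" for s k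
    using ext_diag_ket[OF that] T_eq[OF ket_ell2(1)] by simp
  have tr: "(\<lambda>m. ell2_norm ((Rsh (- h m) \<circ> T \<circ> Rsh (h m)) u - (Rsh (y m) \<circ> Alim \<circ> Rsh (- y m)) u)) \<longlonglongrightarrow> 0"
    "(\<lambda>m. ell2_norm ((Rsh (- h m) \<circ> adj T \<circ> Rsh (h m)) u - (Rsh (y m) \<circ> adj Alim \<circ> Rsh (- y m)) u)) \<longlonglongrightarrow> 0"
    if exh: "\<And>F. finite F \<Longrightarrow> \<forall>\<^sub>F m in sequentially. (\<lambda>g. g + y m) ` F \<subseteq> Y (k m)"
      and h: "\<And>m. h m = v (k m) - y m" and u: "u \<in> ell2" for y k u and h :: "nat \<Rightarrow> 'g"
    using deep_transfer[OF Tb Alim deep Tket op_boundD(2)[OF a ket_ell2(1)] exh h u]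
      deep_transfer[OF Tadjb Aadjb deep' ext_diag_adj_ket[OF Tadj' a'] op_boundD(2)[OF a'b ket_ell2(1)] exh h u]
    by (simp_all add: comp_def)
  have fwd: "(\<exists>vs. op_eq H (Rsh (- vs) \<circ> Alim \<circ> Rsh vs)) \<or> (\<exists>g. tends_to_infinity g \<and> is_limit_op Alim g H)"
    if lim: "is_limit_op T h H" and k: "\<And>n. h n \<in> setmul {v (k n)} (setinv (Y (k n)))"
      and r: "filterlim (\<lambda>n. LEAST r. h n \<in> setmul (setmul {v (k n)} (setinv (bd_Om Om (Y (k n))))) (Omega_pow Om r))
               at_top sequentially" for k
  proof -
    define y where "y = (\<lambda>m. - h m + v (k m))"
    have hy: "h m = v (k m) - y m" for m by (simp add: y_def diff_conv_add_uminus minus_add add.assoc[symmetric] del: add_uminus_conv_diff)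
    have yY: "y m \<in> Y (k m)" for m
      using k[of m] by (auto simp: y_def setmul_def setinv_def minus_add add.assoc)
    have exh: "\<forall>\<^sub>F m in sequentially. (\<lambda>g. g + y m) ` F \<subseteq> Y (k m)" if F: "finite F" for F
    proof -
      obtain R where R: "F \<subseteq> Omega_pow Om R" using Omega_pow_finite_subset[OF Om_gen F] by blast
      have "\<forall>\<^sub>F m in sequentially. R < (LEAST r. h m \<in> setmul (setmul {v (k m)} (setinv (bd_Om Om (Y (k m))))) (Omega_pow Om r))"
        by (rule eventually_compose_filterlim[OF eventually_gt_at_top r])
      then show ?thesis
      proof eventually_elim
        case (elim m)
        have "(\<lambda>w. w + y m) ` Omega_pow Om R \<subseteq> Y (k m)"
        proof (rule Omega_pow_translate_subset[OF yY])
          fix r w assume r: "r \<le> R" "w \<in> Omega_pow Om r"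
          show "w + y m \<notin> bd_Om Om (Y (k m))"
          proof
            assume b: "w + y m \<in> bd_Om Om (Y (k m))"
            \<comment> \<open>A boundary point \<open>w + y m\<close> would exhibit
              \<open>h m\<close> in the set at a stage \<open>r\<close> below the least one. If no
              stage qualifies, \<open>LEAST\<close> is an unspecified number, but still no stage
              below it qualifies, which is all that is used.\<close>
            have "h m = v (k m) + - (w + y m) + w" by (simp add: hy minus_add add.assoc)
            then have "h m \<in> setmul (setmul {v (k m)} (setinv (bd_Om Om (Y (k m))))) (Omega_pow Om r)"
              using b r(2) unfolding setmul_def setinv_def by blast
            moreover have "r < (LEAST r. h m \<in> setmul (setmul {v (k m)} (setinv (bd_Om Om (Y (k m))))) (Omega_pow Om r))"
              using elim r(1) by linarith
            ultimately show False using not_less_Least by blast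
          qed
        qed
        then show ?case using R by blast
      qed
    qed
    have s1: "sconv (\<lambda>m. Rsh (y m) \<circ> Alim \<circ> Rsh (- y m)) H"
    proof (rule sconv_transfer)
      show "sconv (\<lambda>m. Rsh (- h m) \<circ> T \<circ> Rsh (h m)) H" using lim by (simp add: is_limit_op_def)
      show "(Rsh (y m) \<circ> Alim \<circ> Rsh (- y m)) u \<in> ell2" if "u \<in> ell2" for m u
        by (rule op_boundD(2)[OF op_bound_conj_Rsh[OF Alim] that])
      show "(\<lambda>m. ell2_norm ((Rsh (y m) \<circ> Alim \<circ> Rsh (- y m)) u - (Rsh (- h m) \<circ> T \<circ> Rsh (h m)) u)) \<longlonglongrightarrow> 0"
        if "u \<in> ell2" for u by (subst ell2_norm_minus_commute) (rule tr(1)[OF exh hy that])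
    qed
    have s2: "sconv (\<lambda>m. Rsh (y m) \<circ> adj Alim \<circ> Rsh (- y m)) (adj H)"
    proof (rule sconv_transfer)
      show "sconv (\<lambda>m. Rsh (- h m) \<circ> adj T \<circ> Rsh (h m)) (adj H)" using lim by (simp add: is_limit_op_def)
      show "(Rsh (y m) \<circ> adj Alim \<circ> Rsh (- y m)) u \<in> ell2" if "u \<in> ell2" for m u
        by (rule op_boundD(2)[OF op_bound_conj_Rsh[OF Aadjb] that])
      show "(\<lambda>m. ell2_norm ((Rsh (y m) \<circ> adj Alim \<circ> Rsh (- y m)) u - (Rsh (- h m) \<circ> adj T \<circ> Rsh (h m)) u)) \<longlonglongrightarrow> 0"
        if "u \<in> ell2" for u by (subst ell2_norm_minus_commute) (rule tr(2)[OF exh hy that])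
    qed
    show ?thesis
    proof (cases "tends_to_infinity y")
      case True
      have "tends_to_infinity (\<lambda>m. - y m)" unfolding tends_to_infinity_def
      proof (intro allI impI)
        fix F :: "'g set" assume "finite F"
        then have "\<forall>\<^sub>F m in sequentially. y m \<notin> uminus ` F" using True by (simp add: tends_to_infinity_def)
        then show "\<forall>\<^sub>F m in sequentially. - y m \<notin> F" by eventually_elim (metis image_eqI minus_minus)
      qed
      moreover have "is_limit_op Alim (\<lambda>m. - y m) H"
        using s1 s2 lim by (simp add: is_limit_op_def)
      ultimately show ?thesis by blast
    next
      case False
      then obtain F where F: "finite F" "\<not> (\<forall>\<^sub>F m in sequentially. y m \<notin> F)"
        unfolding tends_to_infinity_def by blast
      \<comment> \<open>Pigeonhole: the finite set \<open>F\<close> is visited infinitely often, so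
        one of its points is.\<close>
      obtain y0 where y0: "\<exists>\<^sub>F m in sequentially. y m = y0"
      proof (rule ccontr)
        assume "\<not> thesis"
        then have "\<forall>f\<in>F. \<forall>\<^sub>F m in sequentially. y m \<noteq> f" using that unfolding frequently_def by blast
        then have "\<forall>\<^sub>F m in sequentially. \<forall>f\<in>F. y m \<noteq> f" using F(1) by (simp add: eventually_ball_finite)
        then have "\<forall>\<^sub>F m in sequentially. y m \<notin> F" by (rule eventually_mono) blast
        then show False using F(2) by blast
      qed
      \<comment> \<open>Each coordinate of the conjugates converges and takes the value belonging to
        \<open>y0\<close> infinitely often, so that value is the limit. The required translation is
        \<open>- y0\<close>.\<close>
      have "H u t = (Rsh (- (- y0)) \<circ> Alim \<circ> Rsh (- y0)) u t" if u: "u \<in> ell2" for u t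
      proof (rule ccontr)
        assume ne: "H u t \<noteq> (Rsh (- (- y0)) \<circ> Alim \<circ> Rsh (- y0)) u t"
        have "\<forall>\<^sub>F m in sequentially. (Rsh (y m) \<circ> Alim \<circ> Rsh (- y m)) u t \<noteq> (Rsh (- (- y0)) \<circ> Alim \<circ> Rsh (- y0)) u t"
          by (rule tendsto_imp_eventually_ne[OF sconv_pointwise[OF s1 u] ne])
        then have "\<forall>\<^sub>F m in sequentially. y m \<noteq> y0" by eventually_elim auto
        then show False using y0 by (simp add: frequently_def)
      qed
      then have "op_eq H (Rsh (- (- y0)) \<circ> Alim \<circ> Rsh (- y0))" unfolding op_eq_def by blast
      then show ?thesis by blast
    qed
  qed
  have conv: "\<exists>h'. tends_to_infinity h' \<and> is_limit_op T h' C"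
    if C: "bounded_op C" and c1: "sconv (\<lambda>m. Rsh (- g m) \<circ> Alim \<circ> Rsh (g m)) C"
      and c2: "sconv (\<lambda>m. Rsh (- g m) \<circ> adj Alim \<circ> Rsh (g m)) (adj C)" for g C
  proof -
    \<comment> \<open>Countability of the group gives an increasing exhaustion by finite
      sets.\<close>
    define E :: "nat \<Rightarrow> 'g set" where "E m = to_nat -` {..m}" for m
    have E: "finite (E m)" for m unfolding E_def by (rule finite_vimageI) auto
    have E_ev: "\<forall>\<^sub>F m in sequentially. F \<subseteq> E m" if F: "finite F" for F
    proof -
      obtain N where "\<And>x. x \<in> to_nat ` F \<Longrightarrow> x \<le> N"
        using finite_imageI[OF F, of to_nat] unfolding finite_nat_set_iff_bounded_le by blast
      then have "F \<subseteq> E m" if "m \<ge> N" for m using that by (force simp: E_def)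
      then show ?thesis by (auto simp: eventually_sequentially)
    qed
    \<comment> \<open>Here \<open>- g m\<close> plays the part of \<open>y m\<close>. All large
      \<open>k\<close> satisfy the inclusion, and since \<open>v\<close> is injective only finitely
      many \<open>k\<close> violate the second condition.\<close>
    have "\<exists>k. (\<lambda>f. f + - g m) ` E m \<subseteq> Y k \<and> v k - - g m \<notin> E m" for m
    proof -
      obtain N where N: "\<And>n. n \<ge> N \<Longrightarrow> (\<lambda>f. f + - g m) ` E m \<subseteq> Y n"
        using exhaustion_finite_subset[OF Y_mono Y_union finite_imageI[OF E]] by blast
      have "inj (\<lambda>k. v k - - g m)" using inflating_inj[OF v_infl] by (auto simp: inj_def)
      then have "finite ((\<lambda>k. v k - - g m) -` E m)" by (rule finite_vimageI[OF E])
      then obtain M where "\<And>k. k \<in> (\<lambda>k. v k - - g m) -` E m \<Longrightarrow> k < M"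
        unfolding finite_nat_set_iff_bounded by blast
      then have "max M N \<notin> (\<lambda>k. v k - - g m) -` E m" by (meson leD max.cobounded1)
      moreover have "max M N \<ge> N" by simp
      ultimately show ?thesis using N by blast
    qed
    then obtain k where k: "\<And>m. (\<lambda>f. f + - g m) ` E m \<subseteq> Y (k m)" "\<And>m. v (k m) - - g m \<notin> E m" by metis
    define h' where "h' = (\<lambda>m. v (k m) - - g m)"
    have exh: "\<forall>\<^sub>F m in sequentially. (\<lambda>f. f + - g m) ` F \<subseteq> Y (k m)" if "finite F" for F
      using E_ev[OF that] by eventually_elim (use k(1) in blast)
    have "tends_to_infinity h'" unfolding tends_to_infinity_def
    proof (intro allI impI)
      fix F :: "'g set" assume "finite F"
      from E_ev[OF this] show "\<forall>\<^sub>F m in sequentially. h' m \<notin> F"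
        by eventually_elim (use k(2) in \<open>auto simp: h'_def\<close>)
    qed
    moreover have "sconv (\<lambda>m. Rsh (- h' m) \<circ> T \<circ> Rsh (h' m)) C"
    proof (rule sconv_transfer[OF c1])
      show "(Rsh (- h' m) \<circ> T \<circ> Rsh (h' m)) u \<in> ell2" if "u \<in> ell2" for m u
        by (rule op_boundD(2)[OF op_bound_conj_Rsh[OF Tb] that])
    qed (use tr(1)[OF exh h'_def[THEN fun_cong]] in simp)
    moreover have "sconv (\<lambda>m. Rsh (- h' m) \<circ> adj T \<circ> Rsh (h' m)) (adj C)"
    proof (rule sconv_transfer[OF c2])
      show "(Rsh (- h' m) \<circ> adj T \<circ> Rsh (h' m)) u \<in> ell2" if "u \<in> ell2" for m u
        by (rule op_boundD(2)[OF op_bound_conj_Rsh[OF Tadjb] that])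
    qed (use tr(2)[OF exh h'_def[THEN fun_cong]] in simp)
    ultimately show ?thesis using C unfolding is_limit_op_def by blast
  qed
  have conv1: "\<exists>h'. tends_to_infinity h' \<and> is_limit_op T h' (Rsh (- vs) \<circ> Alim \<circ> Rsh vs)" for vs
  proof -
    let ?C = "Rsh (- vs) \<circ> Alim \<circ> Rsh vs" and ?C' = "Rsh (- vs) \<circ> adj Alim \<circ> Rsh vs"
    have Cb: "op_bound ?C K" by (rule op_bound_conj_Rsh[OF Alim])
    have Cb': "bounded_op ?C" using Cb bounded_op_iff by blast
    have "is_adj ?C ?C'"
      using is_adj_comp[OF is_adj_comp[OF is_adj_Rsh Aadj Alim] is_adj_Rsh op_bound_translate(1), of "- vs" vs]
      by (simp add: comp_assoc)
    then have e: "adj ?C u = ?C' u" if "u \<in> ell2" for u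
      by (rule is_adj_unique[OF is_adj_adj[OF Cb'] _ that])
    have m: "?C u \<in> ell2" "?C' u \<in> ell2" if "u \<in> ell2" for u
      using op_boundD(2)[OF Cb that] op_boundD(2)[OF op_bound_conj_Rsh[OF Aadjb] that] by auto
    \<comment> \<open>Both sequences are constant, and \<open>adj ?C\<close> coincides with
      \<open>?C'\<close> on \<open>ell2\<close>.\<close>
    have "sconv (\<lambda>m. ?C) ?C" using m(1) unfolding sconv_def by (simp del: comp_apply)
    moreover have "sconv (\<lambda>m. ?C') (adj ?C)"
      using m(2) e unfolding sconv_def by (simp del: comp_apply)
    ultimately show ?thesis using conv[OF Cb', of "\<lambda>_. vs"] by blast
  qed
  have conv2: "\<exists>h'. tends_to_infinity h' \<and> is_limit_op T h' C" if "is_limit_op Alim g C" for g C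
    using conv that unfolding is_limit_op_def by blast
  show ?thesis unfolding T_def[symmetric] using fwd conv1 conv2 by blast
qed

end
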